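(* Let \(\mathcal{G}\) be the group given by the presentation \[ \mathcal{G}=\langle x,y,t \mid x^7,\ y^2,\ (xy)^3,\ [x,y]^4,\ t^2,\ [t^{x^2},yx^{-1}],\ [t,y],\ (yt^{x^2})^5,\ (xyx^2t^x)^5,\ (xt)^8\rangle . \] Then \(\mathcal{G}\cong M_{22}\), the Mathieu group of degree 22. In particular, \(M_{22}\) is a homomorphic image of the progenitor \(2^{\star 14}:L_3(2)=\langle x,y,t \mid x^7, y^2, (xy)^3, [x,y]^4, t^2, [t^{x^2},yx^{-1}], [t,y]\rangle\).
   Context: Conventions: \(a^g=g^{-1}ag\) and \([a,b]=a^{-1}b^{-1}ab\). The first four relations present \(L_3(2)\) on \(x,y\). The group \(2^{\star 14}:L_3(2)\) is the semidirect product of the free product of 14 copies of the cyclic group of order 2 (generated by involutions \(t_1,\dots,t_{14}\)) by \(L_3(2)=\langle x,y\rangle\), where \(L_3(2)\) permutes the \(t_i\) according to its transitive 14-point action (the action on the cosets of a subgroup \(A_4\)), given by \(x\mapsto(1,2,3,4,5,6,7)(8,9,10,11,12,13,14)\), \(y\mapsto(1,12)(2,3)(4,11)(5,8)(6,13)(9,10)\), with \(t=t_7\); the displayed seven-relation presentation is a presentation of this semidirect product. *)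

theory Defs
  imports "HOL-Algebra.Algebra" "HOL-Combinatorics.Cycles"
begin

text \<open>A letter is a pair (generator index, inverted?). Words are lists of letters.\<close>
type_synonym letter = "nat \<times> bool"
type_synonym word = "letter list"

definition red_step :: "letter \<Rightarrow> word \<Rightarrow> word" where
  "red_step a acc = (case acc of [] \<Rightarrow> [a]
     | b # rest \<Rightarrow> (if fst a = fst b \<and> snd a \<noteq> snd b then rest else a # acc))"

definition reduce :: "word \<Rightarrow> word" where
  "reduce w = foldr red_step w []"

definition reduced :: "word \<Rightarrow> bool" where
  "reduced w \<longleftrightarrow> (\<forall>i. Suc i < length w \<longrightarrow>
      \<not> (fst (w ! i) = fst (w ! Suc i) \<and> snd (w ! i) \<noteq> snd (w ! Suc i)))"

definition free_grp :: "word monoid" where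
  "free_grp = \<lparr>carrier = {w. reduced w}, monoid.mult = (\<lambda>u v. reduce (u @ v)), one = []\<rparr>"

definition free_grp_on :: "nat set \<Rightarrow> word monoid" where
  "free_grp_on S = \<lparr>carrier = {w. reduced w \<and> fst ` set w \<subseteq> S},
     monoid.mult = (\<lambda>u v. reduce (u @ v)), one = []\<rparr>"

definition normal_closure :: "('a, 'b) monoid_scheme \<Rightarrow> 'a set \<Rightarrow> 'a set" where
  "normal_closure G R = generate G {inv\<^bsub>G\<^esub> g \<otimes>\<^bsub>G\<^esub> r \<otimes>\<^bsub>G\<^esub> g | g r. g \<in> carrier G \<and> r \<in> R}"

definition presented_group :: "nat set \<Rightarrow> word set \<Rightarrow> word set monoid" where
  "presented_group S R = free_grp_on S Mod normal_closure (free_grp_on S) (reduce ` R)"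

definition gen :: "nat \<Rightarrow> word" where "gen i = [(i, False)]"
definition winv :: "word \<Rightarrow> word" where "winv w = rev (map (\<lambda>(i, b). (i, \<not> b)) w)"
definition wpow :: "word \<Rightarrow> nat \<Rightarrow> word" where "wpow w n = concat (replicate n w)"
definition wconj :: "word \<Rightarrow> word \<Rightarrow> word" where "wconj a g = winv g @ a @ g"
definition wcomm :: "word \<Rightarrow> word \<Rightarrow> word" where "wcomm a b = winv a @ winv b @ a @ b"

definition gx :: word where "gx = gen 0"
definition gy :: word where "gy = gen 1"
definition gt :: word where "gt = gen 2"

definition progenitor_relators :: "word set" where
  "progenitor_relators =
    { wpow gx 7, wpow gy 2, wpow (gx @ gy) 3, wpow (wcomm gx gy) 4,
      wpow gt 2, wcomm (wconj gt (wpow gx 2)) (gy @ winv gx), wcomm gt gy }"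

definition G_relators :: "word set" where
  "G_relators = progenitor_relators \<union>
    { wpow (gy @ wconj gt (wpow gx 2)) 5,
      wpow (gx @ gy @ wpow gx 2 @ wconj gt gx) 5,
      wpow (gx @ gt) 8 }"

definition progenitor :: "word set monoid" where
  "progenitor = presented_group {0, 1, 2} progenitor_relators"

definition G_pres :: "word set monoid" where
  "G_pres = presented_group {0, 1, 2} G_relators"

text \<open>Standard (ATLAS) generators of M22 on 22 points.\<close>
definition m22_a :: "nat \<Rightarrow> nat" where
  "m22_a = cycle_of_list [1,13] \<circ> cycle_of_list [2,8] \<circ> cycle_of_list [3,16] \<circ>
     cycle_of_list [4,12] \<circ> cycle_of_list [6,22] \<circ> cycle_of_list [7,17] \<circ>
     cycle_of_list [9,10] \<circ> cycle_of_list [11,14]"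

definition m22_b :: "nat \<Rightarrow> nat" where
  "m22_b = cycle_of_list [1,22,3,21] \<circ> cycle_of_list [2,18,4,13] \<circ> cycle_of_list [5,12] \<circ>
     cycle_of_list [6,11,7,15] \<circ> cycle_of_list [8,14,20,10] \<circ> cycle_of_list [17,19]"

definition M22 :: "(nat \<Rightarrow> nat) monoid" where
  "M22 = (sym_group 22)\<lparr>carrier := generate (sym_group 22) {m22_a, m22_b}\<rparr>"

end

theory Submission
  imports Defs
begin

text \<open>
  Upper bound. In \<open>\<G>\<close> put \<open>u = t x\<^sup>-\<^sup>1 y x t\<close>. Along the chain
  \<open>1 < \<langle>x\<rangle> < \<langle>x, y\<rangle> < \<langle>x, y, u\<rangle> < \<G>\<close>, whose image in \<open>M\<^sub>2\<^sub>2\<close> is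
  \<open>1 < 7 < L\<^sub>3(2) < 2\<^sup>3:L\<^sub>3(2) < M\<^sub>2\<^sub>2\<close>, the indices are at most 7, 24, 8 and 330, so
  \<open>\<bar>\<G>\<bar> \<le> 443520\<close>. Each index is bounded by a Todd-Coxeter enumeration: a certificate lists the
  cosets to define and the relators to trace, and a function that is proved sound replays it.

  Lower bound. Permutations \<open>X, Y, T\<close> of 22 points satisfy the relations, and
  \<open>T = m22_a\<close>, \<open>X\<^sup>2 T X Y = m22_b\<close>; this gives the epimorphisms onto \<open>M\<^sub>2\<^sub>2\<close>. The orbits of a
  stabiliser chain in \<open>M\<^sub>2\<^sub>2\<close> have lengths 22, 21, 20, 16, 3, so \<open>\<bar>M\<^sub>2\<^sub>2\<bar> \<ge> 443520\<close> and
  the epimorphism from \<open>\<G>\<close> is injective.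
\<close>

section \<open>Certified coset enumeration\<close>

text \<open>Counting cosets of the trivial subgroup directly would need a table of 443520 rows,
  which is why a chain is used. Its intermediate subgroups come without presentations. So the step
  from \<open>H\<close> to the next subgroup \<open>K\<close> takes place among the cosets of
  \<open>H\<close> in all of \<open>\<G>\<close>, where the relators of \<open>\<G>\<close> hold,
  and tests only that \<open>n\<close> of these cosets, \<open>H\<close> among them, are permuted
  into each other by generators of \<open>K\<close>. These cosets cover \<open>K\<close>, whence
  \<bar>K\<bar> \<le> n \<bar>H\<bar>.

  As only an upper bound is claimed, different numbers in a table may stand for the same coset. It
  suffices that every number stands for some actual coset; a faulty certificate can only make the
  final test fail. That nothing was overcounted follows at the end, when the upper bound meets the
  lower one.

  The word \<open>u\<close> is the conjugate by \<open>t\<close> of the involution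
  \<open>x\<^sup>-\<^sup>1 y x\<close>. In the image it enlarges L_3(2) to a maximal subgroup
  2^3:L_3(2), so that the index 2640 of L_3(2) splits as 8 times 330.\<close>

text \<open>
  A coset table is a binary trie over \<open>num\<close>; row \<open>c\<close> holds the images of coset \<open>c\<close> under the
  four letters, or forwards to the coset with which \<open>c\<close> has been identified. The functions on
  tables are first-order equations without \<open>if\<close>, \<open>case\<close> and \<open>let\<close>: otherwise the simplifier would
  traverse the whole table again at every step of the evaluation.
\<close>

datatype sym = SX | SX' | SY | ST

fun sinv :: "sym \<Rightarrow> sym" where
  "sinv SX = SX'" | "sinv SX' = SX" | "sinv SY = SY" | "sinv ST = ST"

datatype row = Row "num option" "num option" "num option" "num option" | Fwd num
datatype tab = Leaf | Node tab row tab

fun look :: "tab \<Rightarrow> num \<Rightarrow> row" where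
  "look Leaf k = Row None None None None"
| "look (Node l r m) num.One = r"
| "look (Node l r m) (num.Bit0 k) = look l k"
| "look (Node l r m) (num.Bit1 k) = look m k"

fun upd :: "num \<Rightarrow> row \<Rightarrow> tab \<Rightarrow> tab" where
  "upd num.One v Leaf = Node Leaf v Leaf"
| "upd (num.Bit0 k) v Leaf = Node (upd k v Leaf) (Row None None None None) Leaf"
| "upd (num.Bit1 k) v Leaf = Node Leaf (Row None None None None) (upd k v Leaf)"
| "upd num.One v (Node l r m) = Node l v m"
| "upd (num.Bit0 k) v (Node l r m) = Node (upd k v l) r m"
| "upd (num.Bit1 k) v (Node l r m) = Node l r (upd k v m)"

fun get :: "row \<Rightarrow> sym \<Rightarrow> num option" where
  "get (Row a b c d) SX = a"
| "get (Row a b c d) SX' = b"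
| "get (Row a b c d) SY = c"
| "get (Row a b c d) ST = d"
| "get (Fwd a) s = None"

fun put :: "sym \<Rightarrow> num \<Rightarrow> row \<Rightarrow> row" where
  "put SX k (Row a b c d) = Row (Some k) b c d"
| "put SX' k (Row a b c d) = Row a (Some k) c d"
| "put SY k (Row a b c d) = Row a b (Some k) d"
| "put ST k (Row a b c d) = Row a b c (Some k)"
| "put s k (Fwd a) = Fwd a"

fun chase :: "nat \<Rightarrow> tab \<Rightarrow> num \<Rightarrow> num"
  and chase' :: "nat \<Rightarrow> tab \<Rightarrow> num \<Rightarrow> row \<Rightarrow> num" where
  "chase 0 T c = c"
| "chase (Suc n) T c = chase' n T c (look T c)"
| "chase' n T c (Fwd d) = chase n T d"
| "chase' n T c (Row p q r s) = c"

text \<open>The fuel 8 limits the length of the forwarding chains that are followed. Stopping early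
  does no harm to soundness: every number on the chain stands for the same point.\<close>

definition root :: "tab \<Rightarrow> num \<Rightarrow> num" where "root = chase 8"

text \<open>\<open>root\<close> runs at every letter of every trace, so its fuel is supplied in the
  constructor form on which \<open>chase\<close> matches.\<close>

lemma root_code [code]: "root T c = chase (Suc (Suc (Suc (Suc (Suc (Suc (Suc (Suc 0)))))))) T c"
  by (simp add: root_def numeral_eq_Suc)

fun walk :: "tab \<Rightarrow> num \<Rightarrow> sym list \<Rightarrow> num \<times> sym list"
  and walk' :: "tab \<Rightarrow> num \<Rightarrow> num option \<Rightarrow> sym \<Rightarrow> sym list \<Rightarrow> num \<times> sym list" where
  "walk T c [] = (c, [])"
| "walk T c (s # w) = walk' T c (get (look T c) s) s w"
| "walk' T c None s w = (c, s # w)"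
| "walk' T c (Some d) s w = walk T (root T d) w"

fun fill :: "num option \<Rightarrow> num option \<Rightarrow> num option" where
  "fill None q = q" | "fill (Some a) q = Some a"

fun clash :: "num option \<Rightarrow> num option \<Rightarrow> (num \<times> num) list \<Rightarrow> (num \<times> num) list" where
  "clash (Some a) (Some b) q = (a, b) # q"
| "clash None y q = q"
| "clash (Some a) None q = q"

fun join :: "row \<Rightarrow> row \<Rightarrow> row" where
  "join (Row a b c d) (Row a' b' c' d') = Row (fill a a') (fill b b') (fill c c') (fill d d')"
| "join (Fwd a) r = Fwd a"
| "join (Row a b c d) (Fwd r) = Row a b c d"

fun clashes :: "row \<Rightarrow> row \<Rightarrow> (num \<times> num) list \<Rightarrow> (num \<times> num) list" where
  "clashes (Row a b c d) (Row a' b' c' d') q = clash a a' (clash b b' (clash c c' (clash d d' q)))"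
| "clashes (Fwd a) r q = q"
| "clashes (Row a b c d) (Fwd r) q = q"

text \<open>Entries in other rows that still mention \<open>d\<close> are left alone;
  \<open>root\<close> resolves them when they are read.\<close>

fun redirect :: "num \<Rightarrow> num \<Rightarrow> row \<Rightarrow> row \<Rightarrow> tab \<Rightarrow> tab" where
  "redirect c d r s T = upd d (Fwd c) (upd c (join r s) T)"

fun unify3 :: "num \<Rightarrow> num \<Rightarrow> row \<Rightarrow> row \<Rightarrow> (num \<times> num) list \<Rightarrow> tab \<Rightarrow> (num \<times> num) list \<times> tab" where
  "unify3 c d r s q T = (clashes r s q, redirect c d r s T)"

text \<open>The flags are \<open>a < b\<close> and \<open>b < a\<close>. The smaller number
  survives, so the base point 1 is never redirected.\<close>

fun unify2 :: "bool \<Rightarrow> bool \<Rightarrow> num \<Rightarrow> num \<Rightarrow> (num \<times> num) list \<Rightarrow> tab \<Rightarrow> (num \<times> num) list \<times> tab" where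
  "unify2 True y a b q T = unify3 a b (look T a) (look T b) q T"
| "unify2 False True a b q T = unify3 b a (look T b) (look T a) q T"
| "unify2 False False a b q T = (q, T)"

fun unify1 :: "num \<Rightarrow> num \<Rightarrow> (num \<times> num) list \<Rightarrow> tab \<Rightarrow> (num \<times> num) list \<times> tab" where
  "unify1 a b q T = unify2 (a < b) (b < a) a b q T"

fun merge :: "nat \<Rightarrow> (num \<times> num) list \<times> tab \<Rightarrow> tab" where
  "merge 0 (q, T) = T"
| "merge (Suc n) ([], T) = T"
| "merge (Suc n) ((a, b) # q, T) = merge n (unify1 (root T a) (root T b) q T)"

fun link' :: "num \<Rightarrow> sym \<Rightarrow> num \<Rightarrow> tab \<Rightarrow> tab" where
  "link' b s a T = upd b (put s a (look T b)) T"

fun link :: "num \<Rightarrow> sym \<Rightarrow> num \<Rightarrow> tab \<Rightarrow> tab" where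
  "link a s b T = link' b (sinv s) a (link' a s b T)"

text \<open>The forward and the backward trace of a relator have met (then two cosets coincide) or are
  one letter apart (then a table entry is deduced). The fuel 500 exceeds every cascade of coincidences
  in the certificates.\<close>
fun close :: "num \<Rightarrow> num \<times> sym list \<Rightarrow> tab \<Rightarrow> tab" where
  "close f (b, []) T = merge 500 ([(f, b)], T)"
| "close f (b, [s]) T = link b s f T"
| "close f (b, s # t # w) T = T"

fun scanb :: "num \<Rightarrow> num \<times> sym list \<Rightarrow> tab \<Rightarrow> tab" where
  "scanb a (f, v) T = close f (walk T a (map sinv (rev v))) T"

fun scan' :: "sym list \<Rightarrow> num \<Rightarrow> tab \<Rightarrow> tab" where
  "scan' w a T = scanb a (walk T a w) T"

fun scan :: "sym list \<Rightarrow> num \<Rightarrow> tab \<Rightarrow> tab" where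
  "scan w a T = scan' w (root T a) T"

text \<open>Certificates use integer literals because these are binary in the code generator setup, unlike
  literals of type \<open>nat\<close>.\<close>
definition idx :: "int \<Rightarrow> num" where "idx i = num_of_nat (nat i)"

lemma idx_code [code]: "idx (Int.Pos k) = k" "idx 0 = num.One" "idx (Int.Neg k) = num.One"
  by (simp_all add: idx_def num_of_nat_numeral_eq)

text \<open>The \<open>k\<close>-th entry \<open>(a, s)\<close> of the list defines coset \<open>k + 1\<close> as the image of coset \<open>a\<close>
  under \<open>s\<close>; coset 1 is the base point.\<close>
fun grow :: "num \<Rightarrow> (int \<times> sym) list \<Rightarrow> tab \<Rightarrow> tab" and grow' :: "bool \<Rightarrow> num \<Rightarrow> num \<Rightarrow> sym \<Rightarrow> (int \<times> sym) list \<Rightarrow> tab \<Rightarrow> tab" where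
  "grow n [] T = T"
| "grow n ((a, s) # ds) T = grow' (idx a < n) n (idx a) s ds T"
| "grow' True n a s ds T = grow (Num.inc n) ds (link a s n T)"
| "grow' False n a s ds T = T"

fun pick :: "'a list list \<Rightarrow> nat \<Rightarrow> 'a list" where
  "pick [] n = []" | "pick (x # xs) 0 = x" | "pick (x # xs) (Suc n) = pick xs n"

text \<open>An entry \<open>(a, i)\<close> traces the \<open>i\<close>-th relator at coset \<open>a\<close>.\<close>
fun scans :: "sym list list \<Rightarrow> (int \<times> nat) list \<Rightarrow> tab \<Rightarrow> tab" where
  "scans R [] T = T"
| "scans R ((a, i) # cs) T = scans R cs (scan (pick R i) (idx a) T)"

fun scans0 :: "sym list list \<Rightarrow> tab \<Rightarrow> tab" where
  "scans0 [] T = T"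
| "scans0 (w # ws) T = scans0 ws (scan w num.One T)"

fun inside :: "(num \<Rightarrow> bool) \<Rightarrow> num \<times> sym list \<Rightarrow> bool" where
  "inside P (d, []) = P d" | "inside P (d, s # w) = False"

text \<open>\<open>P\<close> is a test that implies membership in \<open>L\<close>. It is a
  parameter of its own because comparing a number with 330 is cheaper than searching a list of that
  length.\<close>

definition closed :: "(num \<Rightarrow> bool) \<Rightarrow> num list \<Rightarrow> sym list list \<Rightarrow> tab \<Rightarrow> bool" where
  "closed P L W T = list_all (\<lambda>c. list_all (\<lambda>w. inside P (walk T c w)) W) L"

fun nums :: "nat \<Rightarrow> num \<Rightarrow> num list" where
  "nums 0 k = []" | "nums (Suc n) k = k # nums n (Num.inc k)"

lemma look_upd: "look (upd k v T) j = (if j = k then v else look T j)"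
proof (induction k v T arbitrary: j rule: upd.induct)
qed (case_tac j; simp)+

lemma get_put: "get (put s k r) s' = (case r of Fwd d \<Rightarrow> None | _ \<Rightarrow> if s' = s then Some k else get r s')"
  by (cases r; cases s; cases s'; simp)

lemma put_Fwd: "put s k r = Fwd d \<longleftrightarrow> r = Fwd d"
  by (cases r; cases s; simp)

lemma sinv_sinv [simp]: "sinv (sinv s) = s"
  by (cases s) auto

section \<open>Soundness of the table operations for a group action\<close>

locale sym_action =
  fixes \<Omega> :: "'p set" and act :: "sym \<Rightarrow> 'p \<Rightarrow> 'p"
  assumes act_closed: "p \<in> \<Omega> \<Longrightarrow> act s p \<in> \<Omega>"
    and act_inv: "p \<in> \<Omega> \<Longrightarrow> act (sinv s) (act s p) = p"
begin

lemma fold_inv: "p \<in> \<Omega> \<Longrightarrow> fold act (map sinv (rev w)) (fold act w p) = p"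
proof (induction w arbitrary: p)
  case (Cons s w)
  then show ?case by (simp add: act_closed act_inv)
qed simp

text \<open>\<iota> gives the point that each number stands for. It is total and may fail to be
  injective, so rows not yet defined and coincidences not yet discovered are both compatible with
  validity.\<close>

definition valid :: "(num \<Rightarrow> 'p) \<Rightarrow> tab \<Rightarrow> bool" where
  "valid \<iota> T \<longleftrightarrow> range \<iota> \<subseteq> \<Omega>
     \<and> (\<forall>c s d. get (look T c) s = Some d \<longrightarrow> act s (\<iota> c) = \<iota> d)
     \<and> (\<forall>c d. look T c = Fwd d \<longrightarrow> \<iota> c = \<iota> d)"

lemma validD:
  assumes "valid \<iota> T"
  shows "\<iota> c \<in> \<Omega>" "get (look T c) s = Some d \<Longrightarrow> act s (\<iota> c) = \<iota> d" "look T c = Fwd d \<Longrightarrow> \<iota> c = \<iota> d"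
  using assms unfolding valid_def by auto

lemma chase_valid: "valid \<iota> T \<Longrightarrow> \<iota> (chase n T c) = \<iota> c"
proof (induction n arbitrary: c)
  case (Suc n)
  then show ?case by (cases "look T c") (auto simp: validD(3))
qed simp

lemma root_valid: "valid \<iota> T \<Longrightarrow> \<iota> (root T c) = \<iota> c"
  by (simp add: root_def chase_valid)

lemma walk_valid: "valid \<iota> T \<Longrightarrow> walk T c w = (f, v) \<Longrightarrow> fold act w (\<iota> c) = fold act v (\<iota> f)"
proof (induction w arbitrary: c)
  case (Cons s w)
  show ?case
  proof (cases "get (look T c) s")
    case None
    with Cons.prems show ?thesis by auto
  next
    case (Some d)
    with Cons.prems have "fold act w (\<iota> (root T d)) = fold act v (\<iota> f)"
      by (intro Cons.IH) auto
    with Some Cons.prems show ?thesis by (simp add: validD(2) root_valid)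
  qed
qed simp

lemma put_valid:
  assumes "valid \<iota> T" "act s (\<iota> a) = \<iota> b"
  shows "valid \<iota> (upd a (put s b (look T a)) T)"
  using assms unfolding valid_def
  by (auto simp: look_upd get_put put_Fwd split: row.splits if_splits)

lemma link_valid:
  assumes "valid \<iota> T" "act s (\<iota> a) = \<iota> b"
  shows "valid \<iota> (link a s b T)"
proof -
  have "act (sinv s) (\<iota> b) = \<iota> a"
    using assms act_inv[of "\<iota> a" s] validD(1)[OF assms(1)] by metis
  then show ?thesis using assms by (simp add: put_valid)
qed

lemma get_join: "get (join r r') s = Some d \<Longrightarrow> get r s = Some d \<or> get r' s = Some d"
proof -
  have fill: "fill a b = Some d \<Longrightarrow> a = Some d \<or> b = Some d" for a b by (cases a) auto
  show "get (join r r') s = Some d \<Longrightarrow> get r s = Some d \<or> get r' s = Some d"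
    by (cases r; cases r'; cases s) (auto dest: fill)
qed

lemma join_Fwd: "join r r' = Fwd d \<Longrightarrow> r = Fwd d"
  by (cases r; cases r') auto

lemma clashes_sub:
  "(a, b) \<in> set (clashes r r' q) \<Longrightarrow> (a, b) \<in> set q \<or> (\<exists>s. get r s = Some a \<and> get r' s = Some b)"
proof -
  have clash: "(a, b) \<in> set (clash u v q) \<longleftrightarrow> (a, b) \<in> set q \<or> u = Some a \<and> v = Some b" for u v q
    by (cases u; cases v) auto
  show "(a, b) \<in> set (clashes r r' q) \<Longrightarrow> (a, b) \<in> set q \<or> (\<exists>s. get r s = Some a \<and> get r' s = Some b)"
    by (cases r; cases r') (auto simp: clash intro: get.simps)
qed

text \<open>The first component is the queue of coincidences that are known but not yet carried out
  in the table.\<close>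

definition sound :: "(num \<Rightarrow> 'p) \<Rightarrow> (num \<times> num) list \<times> tab \<Rightarrow> bool" where
  "sound \<iota> S \<longleftrightarrow> valid \<iota> (snd S) \<and> (\<forall>(a, b) \<in> set (fst S). \<iota> a = \<iota> b)"

text \<open>Both rows describe the same point. Hence the entries of either are true of the survivor,
  and two images under the same letter are equal, which justifies the new coincidences in the
  queue.\<close>

lemma unify3_sound:
  assumes "valid \<iota> T" "\<iota> c = \<iota> d" "\<forall>(a, b) \<in> set q. \<iota> a = \<iota> b"
  shows "sound \<iota> (unify3 c d (look T c) (look T d) q T)"
proof -
  have "valid \<iota> (upd c (join (look T c) (look T d)) T)"
    using assms(1,2) unfolding valid_def
    by (auto simp: look_upd dest!: get_join join_Fwd split: if_splits) metis+
  then have "valid \<iota> (redirect c d (look T c) (look T d) T)"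
    using assms(2) unfolding valid_def
    by (auto simp: look_upd split: if_splits)
  moreover have "\<forall>(a, b) \<in> set (clashes (look T c) (look T d) q). \<iota> a = \<iota> b"
  proof clarify
    fix a b assume "(a, b) \<in> set (clashes (look T c) (look T d) q)"
    from clashes_sub[OF this] show "\<iota> a = \<iota> b"
    proof (elim disjE exE conjE)
      assume "(a, b) \<in> set q"
      with assms(3) have "case (a, b) of (a, b) \<Rightarrow> \<iota> a = \<iota> b" by (rule bspec)
      then show ?thesis by simp
    next
      fix s assume "get (look T c) s = Some a" "get (look T d) s = Some b"
      note this[THEN validD(2)[OF assms(1)]]
      then show ?thesis using assms(2) by simp
    qed
  qed
  ultimately show ?thesis by (simp add: sound_def)
qed

lemma unify1_sound:
  assumes "valid \<iota> T" "\<iota> a = \<iota> b" "\<forall>(a, b) \<in> set q. \<iota> a = \<iota> b"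
  shows "sound \<iota> (unify1 a b q T)"
proof (cases "a < b")
  case True
  with assms show ?thesis by (simp add: unify3_sound del: unify3.simps)
next
  case False
  with assms unify3_sound[of \<iota> T b a q] show ?thesis
    by (cases "b < a") (simp_all add: sound_def del: unify3.simps)
qed

lemma merge_valid: "sound \<iota> (q, T) \<Longrightarrow> valid \<iota> (merge n (q, T))"
proof (induction n arbitrary: q T)
  case (Suc n)
  show ?case
  proof (cases q)
    case (Cons ab q')
    obtain a b where ab: "ab = (a, b)" by force
    have v: "valid \<iota> T" using Suc.prems by (simp add: sound_def)
    have "sound \<iota> (unify1 (root T a) (root T b) q' T)"
      using Suc.prems by (intro unify1_sound) (auto simp: sound_def Cons ab root_valid)
    then show ?thesis
      using Suc.IH by (metis Cons ab merge.simps(3) prod.collapse)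
  qed (use Suc.prems in \<open>auto simp: sound_def\<close>)
qed (simp add: sound_def)

text \<open>Let the forward trace of \<open>w\<close> stop at \<open>f\<close> with \<open>u\<close>
  unread. As \<open>w\<close> fixes the point of \<open>a\<close>, \<open>u\<close> leads from
  \<open>f\<close> to \<open>a\<close>, so the inverse of \<open>u\<close> leads from
  \<open>a\<close> to \<open>f\<close>. The backward trace stops at \<open>b\<close> with a rest
  \<open>z\<close> that leads from \<open>b\<close> to \<open>f\<close>: an empty \<open>z\<close>
  is a coincidence, a single letter is a table entry.\<close>

lemma scan_valid:
  assumes v: "valid \<iota> T" and w: "fold act w (\<iota> a) = \<iota> a"
  shows "valid \<iota> (scan w a T)"
proof -
  define a' where "a' = root T a"
  have a': "\<iota> a' = \<iota> a" using v by (simp add: a'_def root_valid)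
  obtain f u where fu: "walk T a' w = (f, u)" by force
  obtain b z where bz: "walk T a' (map sinv (rev u)) = (b, z)" by force
  have "fold act u (\<iota> f) = \<iota> a"
    using walk_valid[OF v fu] w by (simp add: a')
  then have "fold act (map sinv (rev u)) (\<iota> a) = \<iota> f"
    using fold_inv[of "\<iota> f" u] validD(1)[OF v] by simp
  then have z: "fold act z (\<iota> b) = \<iota> f"
    using walk_valid[OF v bz] by (simp add: a')
  have "valid \<iota> (close f (b, z) T)"
  proof (cases "(f, (b, z), T)" rule: close.cases)
    case (1 f' b' T')
    with v z show ?thesis by (auto simp: sound_def intro!: merge_valid)
  next
    case (2 f' b' s T')
    with v z show ?thesis by (auto simp: link_valid simp del: link.simps)
  next
    case 3
    with v show ?thesis by auto
  qed
  then show ?thesis by (simp add: a'_def[symmetric] fu bz)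
qed

definition below :: "num \<Rightarrow> tab \<Rightarrow> bool" where
  "below n T \<longleftrightarrow> (\<forall>c s d. get (look T c) s = Some d \<longrightarrow> c < n \<and> d < n) \<and> (\<forall>c d. look T c \<noteq> Fwd d)"

lemma num_less_inc: "c < Num.inc n \<longleftrightarrow> c \<le> n"
  by (simp add: less_num_def less_eq_num_def nat_of_num_inc less_Suc_eq_le)

lemma put_below:
  assumes "below n T" "a < n" "b < n"
  shows "below n (upd a (put s b (look T a)) T)"
  unfolding below_def
proof (intro conjI allI impI)
  fix c s' d
  show "look (upd a (put s b (look T a)) T) c \<noteq> Fwd d"
    using assms by (simp add: below_def look_upd put_Fwd)
  assume "get (look (upd a (put s b (look T a)) T) c) s' = Some d"
  then have "get (look T c) s' = Some d \<or> c = a \<and> d = b"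
    by (auto simp: look_upd get_put split: row.splits if_splits)
  then show "c < n" "d < n" using assms unfolding below_def by blast+
qed

lemma link_below:
  assumes "below n T" "a < n"
  shows "below (Num.inc n) (link a s n T)"
proof -
  have less: "c < Num.inc n" if "c < n" for c using that by (simp add: num_less_inc)
  then have "below (Num.inc n) T" using assms(1) unfolding below_def by blast
  moreover have "n < Num.inc n" by (simp add: num_less_inc)
  ultimately show ?thesis using less[OF assms(2)] by (simp add: put_below)
qed

text \<open>Unlike a scan, a definition changes the interpretation: the fresh number
  \<open>n\<close> receives a new meaning. Nothing breaks because all definitions precede the scans,
  and \<open>below\<close> says that the table does not yet mention \<open>n\<close> and contains no
  forwarding.\<close>

lemma grow_valid:
  assumes "valid \<iota> T" "below n T"
  shows "\<exists>\<iota>'. valid \<iota>' (grow n ds T) \<and> (\<forall>c<n. \<iota>' c = \<iota> c)"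
  using assms
proof (induction ds arbitrary: n T \<iota>)
  case (Cons as ds)
  obtain a s where as: "as = (a, s)" by force
  show ?case
  proof (cases "idx a < n")
    case False
    with Cons.prems show ?thesis by (auto simp: as)
  next
    case True
    define \<iota>1 where "\<iota>1 = \<iota>(n := act s (\<iota> (idx a)))"
    have "valid \<iota>1 T"
      unfolding valid_def
    proof (intro conjI allI impI)
      show "range \<iota>1 \<subseteq> \<Omega>"
        using validD(1)[OF Cons.prems(1)] by (auto simp: \<iota>1_def act_closed)
    next
      fix c s' d assume e: "get (look T c) s' = Some d"
      then have "c \<noteq> n" "d \<noteq> n" using Cons.prems(2) unfolding below_def by blast+
      then show "act s' (\<iota>1 c) = \<iota>1 d"
        using validD(2)[OF Cons.prems(1) e] by (simp add: \<iota>1_def)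
    next
      fix c d assume "look T c = Fwd d"
      then show "\<iota>1 c = \<iota>1 d" using Cons.prems(2) unfolding below_def by blast
    qed
    then have "valid \<iota>1 (link (idx a) s n T)"
      using True by (intro link_valid) (auto simp: \<iota>1_def)
    with link_below[OF Cons.prems(2) True] obtain \<iota>' where
      "valid \<iota>' (grow (Num.inc n) ds (link (idx a) s n T))" "\<forall>c<Num.inc n. \<iota>' c = \<iota>1 c"
      using Cons.IH by blast
    moreover have "\<iota>1 c = \<iota> c" "c < Num.inc n" if "c < n" for c
      using that by (auto simp: \<iota>1_def num_less_inc)
    ultimately show ?thesis
      using True by (auto simp: as simp del: link.simps)
  qed
qed auto

lemma scans_valid:
  assumes "valid \<iota> T" "\<And>w p. w \<in> set R \<Longrightarrow> p \<in> \<Omega> \<Longrightarrow> fold act w p = p"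
  shows "valid \<iota> (scans R C T)"
  using assms(1)
proof (induction C arbitrary: T)
  case (Cons ai C)
  obtain a i where ai: "ai = (a, i)" by force
  have "fold act (pick R i) p = p" if "p \<in> \<Omega>" for p
    using assms(2) that by (induction R i rule: pick.induct) auto
  then have "valid \<iota> (scan (pick R i) (idx a) T)"
    using Cons.prems by (intro scan_valid) (auto simp: validD(1))
  then show ?case using Cons.IH by (simp add: ai del: scan.simps)
qed simp

lemma scans0_valid:
  assumes "valid \<iota> T" "\<And>w. w \<in> set S \<Longrightarrow> fold act w (\<iota> num.One) = \<iota> num.One"
  shows "valid \<iota> (scans0 S T)"
  using assms
proof (induction S arbitrary: T)
  case (Cons w S)
  then have "valid \<iota> (scan w num.One T)" by (intro scan_valid) auto
  then show ?case using Cons by (simp del: scan.simps)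
qed simp

text \<open>The witness is the set of points that the numbers in \<open>L\<close> stand for. A walk
  that reads a whole word and ends in \<open>L\<close> is a true statement about the action, so the
  final test makes this set stable under \<open>W\<close>.\<close>

theorem enumerate_orbit:
  assumes R: "\<And>w p. w \<in> set R \<Longrightarrow> p \<in> \<Omega> \<Longrightarrow> fold act w p = p"
    and S: "\<And>w. w \<in> set S \<Longrightarrow> fold act w p0 = p0"
    and p0: "p0 \<in> \<Omega>"
    and L: "num.One \<in> set L" "\<And>d. P d \<Longrightarrow> d \<in> set L"
    and closed: "closed P L W (scans R C (scans0 S (grow (num.Bit0 num.One) D Leaf)))"
  shows "\<exists>Q \<subseteq> \<Omega>. finite Q \<and> card Q \<le> length L \<and> p0 \<in> Q \<and> (\<forall>q \<in> Q. \<forall>w \<in> set W. fold act w q \<in> Q)"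
proof -
  have empty: "get (Row None None None None) s = None" for s by (cases s) auto
  \<comment> \<open>In the empty table all numbers may stand for \<open>p0\<close>. The number 1
    keeps this meaning because definitions start at 2.\<close>
  have "valid (\<lambda>_. p0) Leaf" "below (num.Bit0 num.One) Leaf"
    using p0 by (auto simp: valid_def below_def empty)
  then obtain \<iota> where v: "valid \<iota> (grow (num.Bit0 num.One) D Leaf)" and "\<forall>c<num.Bit0 num.One. \<iota> c = p0"
    using grow_valid by blast
  then have \<iota>1: "\<iota> num.One = p0" by simp
  define T where "T = scans R C (scans0 S (grow (num.Bit0 num.One) D Leaf))"
  have vT: "valid \<iota> T"
    unfolding T_def using v R S \<iota>1 by (auto intro!: scans_valid scans0_valid)
  have "fold act w (\<iota> c) \<in> \<iota> ` set L" if "c \<in> set L" "w \<in> set W" for c w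
  proof -
    obtain d v where dv: "walk T c w = (d, v)" by force
    have "inside P (walk T c w)"
      using closed that by (auto simp: closed_def T_def list_all_iff)
    then have "v = [] \<and> P d" by (cases v) (auto simp: dv)
    then show ?thesis using walk_valid[OF vT dv] L(2) by auto
  qed
  then show ?thesis
    using L(1) \<iota>1 validD(1)[OF vT] card_image_le[of "set L" \<iota>] card_length[of L]
    by (intro exI[of _ "\<iota> ` set L"]) (auto intro: order_trans)
qed

end

section \<open>Indices of subgroups of a group with three generators\<close>

locale three_generated = group G for G (structure) +
  fixes x y t
  assumes gens [simp]: "x \<in> carrier G" "y \<in> carrier G" "t \<in> carrier G"
    and y_invol: "y \<otimes> y = \<one>" and t_invol: "t \<otimes> t = \<one>"
begin

fun el :: "sym \<Rightarrow> 'a" where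
  "el SX = x" | "el SX' = inv x" | "el SY = y" | "el ST = t"

fun wd :: "sym list \<Rightarrow> 'a" where
  "wd [] = \<one>" | "wd (s # w) = el s \<otimes> wd w"

lemma el_closed [simp]: "el s \<in> carrier G"
  by (cases s) auto

lemma wd_closed [simp]: "wd w \<in> carrier G"
  by (induction w) auto

lemma el_sinv: "el s \<otimes> el (sinv s) = \<one>"
  by (cases s) (auto simp: y_invol t_invol)

lemma wd_append: "wd (v @ w) = wd v \<otimes> wd w"
  by (induction v) (auto simp: m_assoc)

lemma wd_inv: "inv (wd w) = wd (map sinv (rev w))"
proof (induction w)
  case (Cons s w)
  have "inv (el s) = el (sinv s)"
    using el_sinv by (metis el_closed inv_equality sinv_sinv)
  with Cons show ?case by (simp add: inv_mult_group wd_append)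
qed simp

abbreviation coset_act :: "sym \<Rightarrow> 'a set \<Rightarrow> 'a set" where
  "coset_act s C \<equiv> C #> el s"

lemma fold_coset_act: "C \<subseteq> carrier G \<Longrightarrow> fold coset_act w C = C #> wd w"
proof (induction w arbitrary: C)
  case (Cons s w)
  then show ?case by (simp add: r_coset_subset_G coset_mult_assoc)
qed (simp add: coset_mult_one)

lemma coset_action:
  assumes "subgroup H G"
  shows "sym_action (rcosets H) coset_act"
proof
  have sub: "H \<subseteq> carrier G" using assms subgroup.subset by auto
  fix C s assume "C \<in> rcosets H"
  then obtain g where g: "g \<in> carrier G" "C = H #> g" unfolding RCOSETS_def by blast
  show "C #> el s \<in> rcosets H"
    using g sub by (simp add: coset_mult_assoc rcosetsI)
  show "C #> el s #> el (sinv s) = C"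
    using g sub by (simp add: coset_mult_assoc m_assoc el_sinv)
qed

text \<open>Each \<open>k\<close> of the generated subgroup lies in its own coset
  \<open>H #> k\<close>. This coset belongs to the finite orbit \<open>Q\<close> of
  \<open>H\<close>, as \<open>Q\<close> is stable under the listed words and their products. So
  \<open>Q\<close> covers the subgroup with at most \<open>n\<close> sets of size
  \<open>card H\<close>.\<close>

theorem generate_card_le:
  assumes H: "subgroup H G" "finite H" "card H \<le> m"
    and R: "\<And>w. w \<in> set R \<Longrightarrow> wd w = \<one>"
    and S: "\<And>w. w \<in> set S \<Longrightarrow> wd w \<in> H"
    and L: "num.One \<in> set L" "\<And>d. P d \<Longrightarrow> d \<in> set L" "length L = n"
    and W: "(\<lambda>w. map sinv (rev w)) ` set W \<subseteq> set W"
    and closed: "closed P L W (scans R C (scans0 S (grow (num.Bit0 num.One) D Leaf)))"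
  shows "finite (generate G (wd ` set W)) \<and> card (generate G (wd ` set W)) \<le> n * m"
proof -
  interpret A: sym_action "rcosets H" coset_act using coset_action[OF H(1)] .
  have sub: "H \<subseteq> carrier G" using H(1) subgroup.subset by auto
  have carr: "C \<subseteq> carrier G" if "C \<in> rcosets H" for C
    using that sub rcosets_part_G[OF H(1)] by blast
  have HH: "H \<in> rcosets H" using H(1) by (metis coset_mult_one one_closed rcosetsI sub)
  have "fold coset_act w C = C" if "w \<in> set R" "C \<in> rcosets H" for w C
    using that carr by (simp add: fold_coset_act R coset_mult_one)
  moreover have "fold coset_act w H = H" if "w \<in> set S" for w
    using S[OF that] sub by (simp add: fold_coset_act coset_join2 H(1))
  ultimately obtain Q where Q: "Q \<subseteq> rcosets H" "finite Q" "card Q \<le> n" "H \<in> Q"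
    and Qc: "\<And>C w. C \<in> Q \<Longrightarrow> w \<in> set W \<Longrightarrow> fold coset_act w C \<in> Q"
    using A.enumerate_orbit[OF _ _ HH L(1,2) closed] L(3) by metis
  have Qw: "C #> wd w \<in> Q" if "C \<in> Q" "w \<in> set W" for C w
    using Qc[OF that] fold_coset_act carr that(1) Q(1) by (metis subsetD)
  have WG: "wd ` set W \<subseteq> carrier G" by auto
  have Qg: "C #> k \<in> Q" if "k \<in> generate G (wd ` set W)" "C \<in> Q" for C k
    using that
  proof (induction k arbitrary: C rule: generate.induct)
    case one
    then show ?case using carr Q(1) by (auto simp: coset_mult_one)
  next
    case (incl h)
    then show ?case using Qw by auto
  next
    case (inv h)
    then obtain w where "w \<in> set W" "h = wd w" by auto
    with inv W show ?case by (auto simp: wd_inv intro!: Qw)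
  next
    case (eng h k)
    then have "h \<in> carrier G" "k \<in> carrier G"
      using generate_in_carrier[OF WG] by auto
    with eng carr Q(1) show ?case
      by (metis coset_mult_assoc subsetD)
  qed
  have fin: "finite C" "card C \<le> m" if "C \<in> Q" for C
    using that Q(1) sub H rcosets_finite card_rcosets_equal by (metis subsetD)+
  have "k \<in> \<Union>Q" if "k \<in> generate G (wd ` set W)" for k
  proof -
    have "k \<in> carrier G" using generate_in_carrier[OF WG that] .
    then have "k \<in> H #> k" using rcos_self H(1) by blast
    with Qg[OF that Q(4)] show ?thesis by blast
  qed
  then have "generate G (wd ` set W) \<subseteq> \<Union>Q" by blast
  moreover have "finite (\<Union>Q)" using Q(2) fin(1) by auto
  moreover have "card (\<Union>Q) \<le> (\<Sum>C\<in>Q. card C)"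
    using card_Union_le_sum_card by blast
  moreover have "(\<Sum>C\<in>Q. card C) \<le> n * m"
    using sum_bounded_above[of Q card m] fin(2) Q(3) by (simp add: mult_le_mono1 order_trans)
  ultimately show ?thesis
    by (meson card_mono finite_subset order_trans)
qed

end

section \<open>The certificates\<close>

lemma set_nums: "set (nums n k) = {d. k \<le> d \<and> nat_of_num d < nat_of_num k + n}"
proof (induction n arbitrary: k)
  case (Suc n)
  have "d = k \<or> Num.inc k \<le> d \<longleftrightarrow> k \<le> d" for d
    by (auto simp: less_eq_num_def nat_of_num_inc Suc_le_eq num_eq_iff)
  with Suc show ?case by (auto simp: nat_of_num_inc less_eq_num_def num_eq_iff)
qed (auto simp: less_eq_num_def)

text \<open>Connects the comparison that serves as the test \<open>P\<close> in the certificates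
  with the list of the first \<open>n\<close> numbers.\<close>

lemma le_idx: "0 < n \<Longrightarrow> d \<le> idx (int n) \<Longrightarrow> d \<in> set (nums n num.One)"
  using nat_of_num_pos[of d] by (simp add: set_nums idx_def less_eq_num_def num_of_nat_inverse)

lemma length_nums: "length (nums n k) = n"
  by (induction n arbitrary: k) auto

definition pw :: "nat \<Rightarrow> 'a list \<Rightarrow> 'a list" where
  "pw n w = concat (replicate n w)"

text \<open>The relators are freely reduced, and \<open>y\<^sup>2\<close>, \<open>t\<^sup>2\<close> are missing because \<open>sinv\<close> treats
  \<open>y\<close> and \<open>t\<close> as involutions.\<close>
definition rels :: "sym list list" where
  "rels = [pw 7 [SX], pw 3 [SX, SY], pw 4 [SX', SY, SX, SY],
    [SX', SX', ST, SX, SX, SX, SY, SX', SX', ST, SX, SX, SY, SX'],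
    [ST, SY, ST, SY],
    pw 5 [SY, SX', SX', ST, SX, SX],
    pw 5 [SX, SY, SX, ST, SX],
    pw 8 [SX, ST]]"

definition enumerates :: "(num \<Rightarrow> bool) \<Rightarrow> num list \<Rightarrow> sym list list \<Rightarrow> sym list list \<Rightarrow>
    (int \<times> sym) list \<Rightarrow> (int \<times> nat) list \<Rightarrow> bool" where
  "enumerates P L W S D C \<longleftrightarrow> closed P L W (scans rels C (scans0 S (grow (num.Bit0 num.One) D Leaf)))"

text \<open>Words for generators of the subgroups in the chain; they must be closed under inversion
  because orbits are followed only along the listed words.\<close>
definition W1 :: "sym list list" where "W1 = [[SX], [SX']]"
definition W2 :: "sym list list" where "W2 = [[SX], [SX'], [SY]]"
definition W3 :: "sym list list" where "W3 = [[SX], [SX'], [SY], [ST, SX', SY, SX, ST]]"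
definition W4 :: "sym list list" where "W4 = [[SX], [SX'], [SY], [ST]]"

text \<open>The definitions form a path from 1 to 7 along \<open>x\<close>; tracing x^7 at 1 closes
  it to a cycle.\<close>

definition c7_defs :: "(int \<times> sym) list" where
  "c7_defs = [
   (1,SX), (2,SX), (3,SX), (4,SX), (5,SX), (6,SX)]"

definition c7_scans :: "(int \<times> nat) list" where
  "c7_scans = [
   (1,0)]"

definition c24_defs :: "(int \<times> sym) list" where
  "c24_defs = [
   (1,SY), (2,SX), (2,SX'), (3,SX), (4,SX'), (5,SY), (5,SX), (6,SY), (6,SX'), (7,SX'), (8,SY),
   (9,SX), (10,SY), (11,SY), (11,SX'), (12,SX'), (13,SY), (13,SX), (14,SX), (16,SX'), (17,SX'),
   (21,SY), (22,SY)]"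

definition c24_scans :: "(int \<times> nat) list" where
  "c24_scans = [
   (1,1), (6,1), (6,0), (11,1), (9,1), (4,2), (13,1), (14,1), (16,0), (17,0), (19,1), (20,1)]"

text \<open>The first five definitions spell \<open>u\<close> at coset 1, so coset 6 is the image of
  the base point under \<open>u\<close>; cosets 7 to 12 arise from 6 by words in \<open>x\<close>
  and \<open>y\<close>. Thus the orbit of length 8 is 1 together with seven cosets permuted by
  \<langle>x, y\<rangle>. All other entries are auxiliary, and the table has fewer than half as many
  rows as there are cosets of \<langle>x, y\<rangle> in \<open>\<G>\<close>, namely 2640.\<close>

definition c8_defs :: "(int \<times> sym) list" where
  "c8_defs = [
   (1,ST), (2,SX'), (3,SY), (4,SX), (5,ST), (6,SX), (6,SX'), (7,SX), (7,SY), (9,SX), (10,SX'),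
   (7,ST), (13,SX'), (14,SY), (8,ST), (16,SX'), (9,ST), (10,ST), (19,SX'), (20,SY), (11,ST),
   (12,ST), (23,SX'), (2,SX), (25,SX), (25,ST), (25,SY), (3,SX'), (3,ST), (26,ST), (26,SX),
   (27,SX'), (27,SX), (27,SY), (28,SX'), (4,ST), (29,SY), (29,SX'), (29,ST), (30,SX'), (30,SX),
   (31,SX'), (31,SX), (31,SY), (33,SX'), (33,SY), (34,SY), (34,ST), (34,SX), (35,SX), (35,SX'),
   (36,ST), (36,SX'), (37,SX'), (37,SX), (5,SY), (38,ST), (38,SX), (39,ST), (40,SX), (40,SX'),
   (41,SX'), (41,ST), (41,SY), (42,SY), (42,SX), (43,ST), (43,SX'), (43,SY), (44,SX), (44,SY),
   (45,SX'), (45,SX), (46,ST), (46,SX'), (46,SY), (47,SX'), (47,SX), (48,SX'), (48,ST), (48,SX),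
   (49,SX), (49,SX'), (50,SY), (50,SX), (50,ST), (51,SX), (52,ST), (52,SX'), (53,SX'), (53,SX),
   (54,ST), (55,SX'), (55,SY), (56,ST), (56,SX), (56,SY), (58,SX'), (58,SX), (59,ST), (60,SX),
   (60,SX'), (61,SY), (61,ST), (61,SX), (62,SX'), (62,SY), (62,ST), (63,SX'), (63,SY), (64,SX'),
   (64,SY), (64,SX), (65,SX), (66,SX'), (67,SY), (68,SX'), (68,SX), (68,SY), (69,SY), (69,SX'),
   (70,SX), (70,SX'), (71,SX), (71,ST), (71,SY), (72,SX'), (72,SX), (73,SX'), (74,ST), (74,SX),
   (75,SX'), (75,SX), (75,SY), (76,SY), (77,SX'), (77,SX), (78,SX'), (78,ST), (79,SX), (79,ST),
   (80,SX'), (80,ST), (81,SX), (81,SX'), (82,ST), (82,SX), (83,SX), (83,SY), (84,ST), (85,ST),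
   (86,SY), (86,ST), (87,SX), (88,SY), (88,SX), (89,SX), (90,SY), (90,SX'), (91,SX'), (91,ST),
   (91,SY), (92,SX), (92,SY), (92,ST), (93,SX), (93,SX'), (94,SX'), (94,ST), (94,SY), (95,SX),
   (96,SY), (97,ST), (97,SX), (98,SX'), (8,SX'), (8,SY), (99,SY), (99,SX'), (100,SY), (100,ST),
   (100,SX), (101,SX), (101,SX'), (102,SY), (102,SX), (102,ST), (103,SX'), (103,SY), (103,ST),
   (104,ST), (104,SX'), (105,SX), (105,SX'), (106,SY), (106,SX), (107,SX'), (108,ST), (109,SX),
   (110,ST), (111,SX'), (111,SX), (112,SY), (112,SX'), (113,SX'), (114,ST), (114,SX), (114,SY),
   (115,SX), (115,ST), (116,SY), (116,SX'), (118,SY), (118,SX'), (119,SX), (119,SY), (119,ST),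
   (120,SX'), (120,SX), (121,SX), (121,SX'), (123,ST), (123,SX), (124,SX'), (125,ST), (126,SY),
   (127,SX), (128,ST), (128,SX'), (129,SX), (130,SX'), (131,SX'), (131,SX), (132,SX), (132,ST),
   (133,SX'), (133,SY), (134,SY), (134,SX), (135,SX'), (135,SX), (136,SX), (137,ST), (138,SX),
   (139,SY), (139,SX'), (139,ST), (140,SX), (141,SX), (142,SX'), (142,SX), (143,ST), (143,SX'),
   (144,SX'), (144,SX), (145,SX), (146,SX'), (146,SY), (147,SX), (148,SX), (148,SY), (148,ST),
   (149,SY), (151,SX'), (151,SY), (152,SX), (153,ST), (154,SX), (154,SX'), (155,SX), (155,ST),
   (157,ST), (158,SX), (159,SX), (160,ST), (162,SX), (165,SX'), (166,SX), (167,SX), (167,ST),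
   (167,SY), (168,ST), (168,SY), (168,SX'), (169,SY), (169,ST), (170,SX), (170,SY), (171,SX'),
   (171,SX), (172,ST), (172,SX), (174,SX'), (174,SX), (176,SX'), (176,ST), (13,SX), (16,SY),
   (16,SX), (177,SX'), (177,SY), (178,SX), (181,ST), (182,SX), (184,ST), (185,SY), (185,SX'),
   (186,SX'), (186,ST), (187,SY), (188,SX'), (188,SX), (189,ST), (189,SX'), (190,ST), (191,SX),
   (191,SX'), (192,SX), (193,ST), (193,SX'), (194,SX), (194,SY), (195,ST), (195,SX'), (195,SY),
   (198,SY), (199,SX), (199,SX'), (200,SX), (200,SY), (201,SX), (201,SX'), (202,ST), (203,SX),
   (203,ST), (204,SX), (205,SX'), (205,SY), (206,SX'), (206,SY), (207,SX), (207,SY), (208,SX),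
   (210,SX), (211,SX'), (211,SX), (212,ST), (213,SX'), (213,SY), (214,SX'), (214,SX), (215,SY),
   (215,SX'), (215,ST), (216,SY), (216,SX), (217,SX), (217,SX'), (217,ST), (218,SX), (219,SX'),
   (220,ST), (220,SX), (221,SX), (221,ST), (222,ST), (223,SX'), (225,ST), (225,SX'), (226,SX),
   (227,SX), (227,SX'), (228,ST), (229,SX), (229,SX'), (230,SX'), (231,ST), (231,SX), (231,SY),
   (233,ST), (234,SX), (236,SX), (237,SY), (237,SX'), (238,SX), (238,SX'), (239,SX'), (239,SX),
   (240,SX), (240,SY), (241,ST), (242,SX), (243,ST), (244,SX'), (244,SX), (246,ST), (248,SX'),
   (248,SX), (249,SY), (249,SX), (251,SX'), (252,SX), (253,SX'), (253,SX), (255,SY), (255,SX'),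
   (256,SY), (256,SX), (257,SX), (257,SY), (258,SY), (258,SX'), (260,SX), (262,ST), (263,SX),
   (265,SY), (265,SX'), (266,SX'), (266,SX), (267,SX), (268,SX), (269,SY), (269,SX), (270,ST),
   (270,SY), (270,SX'), (271,SX), (272,SX), (272,SX'), (273,SX), (273,SX'), (274,SX), (275,ST),
   (276,SX), (276,SX'), (277,SX), (278,SX'), (279,SX), (279,ST), (281,SY), (281,SX), (283,SY),
   (283,SX'), (285,SX'), (285,ST), (286,ST), (287,SX), (288,SX), (289,SX), (289,SX'), (290,ST),
   (292,SX), (292,SX'), (293,ST), (294,SY), (294,SX'), (295,SX), (296,ST), (297,SX), (18,SX),
   (298,ST), (298,SX), (298,SY), (17,SX'), (300,SX), (302,SX'), (304,SX'), (304,SX), (305,SX),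
   (305,SY), (306,SX), (310,SX), (312,SX'), (313,SX), (314,SX'), (315,ST), (316,SX), (316,SX'),
   (317,SY), (317,SX), (318,SY), (319,SX), (319,SY), (320,SX), (322,SY), (322,SX), (323,SX'),
   (324,SY), (325,SY), (325,SX'), (328,SX), (329,SY), (330,SX), (330,SY), (331,SX'), (332,SX),
   (333,SY), (334,SX), (334,SX'), (335,ST), (336,SX), (336,SX'), (337,SY), (338,SY), (340,SY),
   (341,SX), (342,SY), (343,SX), (344,SY), (346,SX'), (347,SY), (347,SX), (348,SX), (351,ST),
   (352,SY), (352,ST), (353,SX), (353,ST), (354,SY), (355,SX'), (355,SX), (356,SX'), (356,SX),
   (358,SX), (359,SX'), (360,SX), (360,SX'), (361,SY), (362,SY), (362,SX'), (363,SX), (364,SY),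
   (364,SX), (366,SX), (367,SX), (368,SY), (368,SX'), (369,SX'), (369,SX), (371,SY), (371,SX),
   (372,SX), (373,SX'), (374,SX'), (375,SY), (375,SX), (376,SX'), (376,SY), (377,ST), (378,SX),
   (381,SX'), (381,SY), (382,SY), (383,SX), (383,SY), (384,SX'), (385,SY), (386,SX), (387,SX'),
   (388,SX'), (388,SY), (389,ST), (389,SX), (390,SY), (391,SX'), (392,SX), (393,SY), (394,SX),
   (396,ST), (397,SX'), (397,SX), (398,SX'), (398,SY), (399,SX), (399,SY), (400,SX'), (401,ST),
   (401,SY), (402,SX'), (402,ST), (402,SY), (403,SX), (404,SX'), (405,SY), (406,SX), (407,SX'),
   (407,SY), (408,SX'), (409,SY), (409,SX), (411,SX'), (412,SX), (413,SY), (414,SY), (416,SY),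
   (417,SX'), (417,SX), (418,SY), (418,SX'), (419,ST), (419,SX'), (421,SY), (421,SX), (422,SX),
   (422,SY), (423,SX'), (424,SX), (424,SY), (425,SX), (425,SY), (425,SX'), (426,SX), (427,SX'),
   (427,SY), (429,SX), (430,ST), (431,SX), (432,SX'), (432,SY), (434,SX), (436,SY), (436,SX'),
   (440,SX), (441,SX'), (441,SX), (442,SX), (442,SY), (443,SX'), (444,ST), (444,SX'), (444,SY),
   (446,SX'), (446,SX), (447,SX), (447,SX'), (448,SY), (449,SX), (449,SY), (450,SX), (451,SX'),
   (453,SX), (453,SY), (454,SX'), (455,SX), (456,SX), (457,SY), (457,SX'), (458,SX), (459,SX'),
   (459,SX), (460,SX), (460,ST), (461,SX), (461,SY), (462,SX), (462,SY), (462,SX'), (463,SY),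
   (463,SX), (465,SY), (465,SX'), (466,SY), (468,SX'), (468,SY), (469,SX), (469,ST), (472,SY),
   (473,SX), (474,SX'), (475,SX), (476,SY), (477,SX'), (478,SY), (478,ST), (478,SX), (479,SY),
   (480,SX'), (481,SY), (481,SX), (482,SX), (484,SX'), (485,SY), (486,SX), (487,SY), (489,SX'),
   (490,SX), (491,SY), (495,SX'), (496,ST), (497,SY), (498,SX), (499,SX), (500,SY), (500,SX'),
   (501,SX'), (502,SY), (502,SX), (503,SX'), (506,SX'), (509,SX), (511,SX'), (512,SX'), (513,SX),
   (514,SX), (514,ST), (515,SX'), (516,ST), (517,SX), (518,SX), (518,SY), (519,SX), (521,SX'),
   (521,SY), (522,SY), (522,SX), (523,SX'), (524,SX), (525,SY), (526,SY), (526,ST), (527,SX),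
   (528,SX'), (528,SY), (530,SX), (531,ST), (531,SY), (532,SY), (532,SX), (534,SY), (535,SY),
   (535,ST), (536,SY), (536,SX), (538,SY), (539,SY), (539,SX'), (540,SX), (541,SX'), (542,SY),
   (542,SX), (543,SX), (544,SX'), (545,SY), (547,SX), (548,SY), (548,SX'), (550,SX'), (551,SX),
   (552,SX'), (555,SY), (556,SX'), (560,SX'), (560,SY), (561,SX'), (561,SY), (564,SY), (564,SX),
   (565,SX), (567,SY), (567,SX), (569,SX), (570,SX'), (570,SX), (571,SY), (572,SY), (573,SY),
   (573,SX'), (575,SX), (576,SX'), (577,SY), (578,SY), (578,SX), (579,SX'), (581,SX), (584,SX'),
   (586,SY), (586,SX), (589,ST), (589,SX'), (589,SY), (593,SX), (593,SY), (595,SX), (598,SX),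
   (598,SY), (599,SX), (601,SX), (601,SX'), (605,SY), (607,SX'), (607,SY), (610,SY), (610,ST),
   (610,SX), (611,SX), (612,SY), (612,SX'), (613,SY), (613,ST), (613,SX), (615,SX), (616,SY),
   (617,SY), (619,SY), (620,SX), (622,SX), (623,SY), (624,ST), (625,SX'), (625,SY), (626,SX),
   (627,SX), (629,SX'), (630,SX), (630,SX'), (633,ST), (634,SX), (636,SX'), (636,SY), (637,SX'),
   (638,SY), (641,SX'), (645,SY), (646,SX), (646,SY), (648,SY), (650,SX'), (650,SY), (652,SX),
   (653,SX), (654,ST), (656,SY), (656,SX), (657,SX'), (660,ST), (666,ST), (667,SX), (670,ST),
   (673,SX'), (673,SY), (674,ST), (675,SX), (677,SX), (678,SY), (681,SX), (681,SY), (683,SX'),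
   (686,SX'), (687,SY), (690,SX'), (691,SX), (692,ST), (692,SX), (696,SY), (696,SX'), (697,SX'),
   (701,ST), (705,SX), (706,SX), (707,SY), (708,SX), (708,SX'), (709,SY), (710,SY), (710,SX),
   (712,SX), (713,SY), (713,SX'), (714,SX), (715,SX'), (716,SY), (716,SX), (718,SY), (720,ST),
   (721,SX), (721,SX'), (722,SY), (722,SX), (723,SY), (723,SX'), (725,SX), (726,SY), (726,SX),
   (731,ST), (732,SX), (737,SX'), (738,SX), (739,SY), (752,ST), (763,SY), (763,SX'), (764,SX),
   (772,SX'), (773,SY), (775,SY), (775,SX), (784,ST), (788,SX), (788,SY), (789,SY), (789,SX'),
   (793,SX'), (794,SX), (795,SY), (795,SX), (796,SX), (796,SY), (798,SY), (798,SX'), (799,ST),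
   (800,SX), (800,SX'), (805,SX'), (809,SX), (815,SX), (823,ST), (831,SX), (832,SX), (833,SX'),
   (833,SX), (834,SY), (835,SX'), (836,SX'), (838,SX), (838,SY), (839,SX), (851,SY), (853,SX'),
   (860,SX), (862,SX), (863,SY), (863,SX'), (864,SX'), (867,SY), (868,SX'), (868,SX), (869,SY),
   (871,SY), (872,SX'), (873,SY), (875,SX), (876,SY), (877,SX'), (883,SX'), (886,SX), (892,SX'),
   (892,SY), (897,SY), (898,SX), (899,SX), (902,SX'), (903,SY), (905,SX'), (910,SY), (911,SX'),
   (912,SX), (914,ST), (916,SX), (919,SX)]"

definition c8_scans :: "(int \<times> nat) list" where
  "c8_scans = [
   (1,4), (3,1), (1,3), (25,4), (4,4), (29,0), (36,1), (26,4), (4,1), (38,2), (6,4), (38,4),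
   (38,0), (38,1), (39,4), (33,1), (48,4), (48,1), (67,3), (50,5), (34,3), (50,0), (55,1),
   (37,1), (59,4), (63,0), (80,1), (43,4), (43,1), (71,0), (39,3), (72,1), (46,4), (46,1),
   (82,4), (50,1), (5,3), (90,0), (4,3), (56,4), (97,0), (56,1), (8,1), (99,1), (58,1), (54,3),
   (97,3), (36,3), (60,1), (103,1), (104,4), (187,3), (107,0), (108,4), (110,4), (63,1), (111,1),
   (116,1), (69,1), (74,1), (125,4), (71,4), (127,0), (127,1), (132,0), (132,1), (136,1),
   (137,4), (139,1), (246,0), (161,2), (115,1), (141,0), (143,2), (80,3), (254,4), (72,3),
   (146,1), (148,0), (261,1), (82,1), (148,1), (35,2), (153,4), (157,4), (92,1), (106,3),
   (168,1), (175,1), (286,0), (94,4), (94,1), (60,2), (171,1), (172,1), (122,1), (59,3), (10,4),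
   (8,4), (177,0), (12,1), (181,4), (185,1), (185,0), (308,2), (123,1), (187,1), (189,2),
   (190,4), (193,0), (197,1), (202,4), (203,0), (203,4), (206,1), (114,4), (208,0), (210,0),
   (210,1), (213,0), (321,1), (213,1), (118,1), (216,0), (217,1), (217,4), (221,0), (222,4),
   (225,4), (225,0), (160,1), (228,4), (254,1), (231,0), (168,2), (231,1), (133,1), (239,1),
   (240,0), (243,4), (246,4), (258,0), (262,4), (278,0), (274,3), (167,4), (285,0), (186,6),
   (163,3), (286,4), (290,4), (293,4), (296,4), (11,4), (177,1), (302,2), (216,3), (71,5),
   (305,3), (304,1), (315,4), (192,1), (325,0), (271,3), (329,1), (61,3), (333,1), (204,1),
   (42,3), (344,5), (194,3), (342,3), (351,4), (214,1), (353,4), (357,1), (356,1), (364,0),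
   (226,1), (257,3), (377,4), (437,3), (237,1), (388,1), (389,4), (27,3), (566,3), (403,0),
   (250,3), (405,1), (409,0), (82,3), (592,3), (265,1), (418,0), (523,1), (212,3), (268,1),
   (46,3), (270,4), (427,0), (90,3), (432,1), (436,0), (283,1), (497,3), (458,0), (421,3),
   (20,1), (298,4), (466,3), (463,5), (298,3), (349,3), (642,0), (263,1), (463,0), (465,0),
   (642,1), (453,1), (137,3), (469,4), (472,1), (202,3), (475,0), (316,1), (171,3), (458,3),
   (479,1), (102,3), (382,5), (234,3), (319,1), (486,0), (486,1), (322,1), (197,3), (324,1),
   (330,1), (689,3), (500,1), (309,3), (340,1), (347,1), (513,0), (516,4), (353,1), (523,3),
   (528,1), (96,3), (535,1), (15,1), (513,3), (69,3), (543,1), (544,0), (545,1), (548,0),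
   (550,0), (551,6), (203,3), (693,0), (178,3), (512,3), (22,1), (461,2), (735,1), (654,1),
   (463,3), (538,2), (452,1), (18,3), (581,4), (18,0), (640,3), (560,1), (564,0), (565,1),
   (547,3), (571,1), (397,1), (575,0), (575,1), (769,1), (419,2), (573,1), (516,2), (399,1),
   (577,1), (401,4), (774,3), (584,0), (406,1), (588,2), (631,1), (777,2), (589,1), (781,0),
   (412,1), (417,1), (785,2), (530,1), (599,1), (605,1), (607,1), (792,0), (426,1), (562,1),
   (625,1), (222,3), (627,0), (627,1), (636,0), (636,1), (449,1), (37,3), (641,0), (752,1),
   (455,1), (645,1), (824,0), (456,1), (649,1), (650,1), (652,1), (660,4), (673,1), (674,4),
   (678,1), (845,0), (699,2), (485,1), (569,1), (686,2), (548,1), (504,2), (498,3), (490,1),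
   (691,0), (332,6), (819,3), (692,1), (696,1), (502,1), (697,2), (552,1), (557,2), (811,1),
   (701,4), (185,3), (707,1), (710,0), (435,6), (574,3), (456,0), (729,2), (755,1), (645,3),
   (455,2), (567,1), (792,3), (791,3), (728,0), (623,1), (316,2), (736,1), (716,0), (524,1),
   (720,4), (528,2), (723,0), (880,1), (673,2), (840,1), (841,3), (848,4), (727,2), (802,1),
   (786,0), (613,1), (696,2), (531,4), (731,4), (738,0), (738,1), (739,1), (534,3), (598,4),
   (550,3), (772,2), (805,1), (578,1), (688,2), (581,1), (611,1), (798,0), (799,4), (805,0),
   (619,1), (809,7), (823,4), (833,1), (893,3), (834,5), (656,3), (795,3), (424,5), (838,3),
   (601,1), (667,1), (818,5), (634,3), (863,1), (907,3), (713,1), (871,1), (940,3), (68,3),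
   (876,1), (892,0), (920,1), (260,6), (902,0), (903,1), (954,3), (906,1), (912,6), (924,1),
   (518,3), (931,0), (864,3), (805,6), (958,0), (895,3), (947,1), (920,3), (207,3), (919,1),
   (395,3), (911,2), (929,4), (912,3), (957,5), (909,2), (943,1), (793,2), (868,0), (877,3),
   (944,0), (940,1), (884,6), (620,3), (927,6)]"

text \<open>The 8 cosets are not the first 8 of the table, as the steps of the word \<open>u\<close> lead out of
  \<open>\<langle>x, y, u\<rangle>\<close>.\<close>
definition c8_reps :: "num list" where "c8_reps = map idx [1, 6, 7, 8, 9, 10, 11, 12]"

text \<open>The cosets that remain are numbered first. The later entries are auxiliary and are
  absorbed by coincidences, since the smaller number survives.\<close>

definition c330_defs :: "(int \<times> sym) list" where
  "c330_defs = [
   (1,ST), (2,SX), (2,SX'), (3,ST), (3,SY), (3,SX), (4,ST), (5,SY), (5,SX), (5,SX'), (6,SX'),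
   (7,ST), (7,SY), (8,SX), (8,SX'), (9,SX), (9,SX'), (10,ST), (10,SY), (10,SX), (11,SX'),
   (12,ST), (13,SY), (13,SX), (13,SX'), (15,SY), (15,SX), (16,ST), (16,SX'), (17,ST), (17,SX),
   (18,ST), (19,SY), (19,SX), (19,SX'), (20,SX'), (21,ST), (21,SX), (22,ST), (22,SX'), (23,SX),
   (23,SX'), (24,SX), (24,SX'), (25,ST), (25,SY), (25,SX), (26,ST), (28,ST), (28,SY), (29,SX),
   (29,SX'), (30,ST), (30,SX'), (31,SX), (31,SX'), (32,SY), (32,SX), (34,SX), (34,SX'), (35,ST),
   (35,SY), (35,SX), (36,SX'), (37,ST), (39,ST), (40,SX), (40,SX'), (41,ST), (41,SY), (42,ST),
   (42,SX), (43,ST), (44,ST), (44,SX), (45,ST), (46,SY), (46,SX), (46,SX'), (48,ST), (49,SX),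
   (49,SX'), (50,SY), (50,SX), (50,SX'), (52,ST), (52,SY), (52,SX), (53,ST), (53,SY), (53,SX'),
   (54,SX), (54,SX'), (55,ST), (56,ST), (56,SY), (56,SX), (57,SX'), (59,ST), (60,ST), (60,SX),
   (61,ST), (61,SY), (61,SX'), (62,SY), (62,SX'), (63,SX'), (64,ST), (64,SX), (65,ST), (65,SX'),
   (66,SX), (66,SX'), (67,SX), (67,SX'), (68,ST), (68,SX), (69,ST), (69,SX'), (70,SY), (70,SX),
   (70,SX'), (72,SX'), (73,ST), (73,SY), (74,SX), (74,SX'), (75,SX), (75,SX'), (76,ST), (77,SX'),
   (78,SX), (79,ST), (79,SX), (80,SX'), (81,SX), (82,SY), (82,SX), (83,ST), (83,SY), (83,SX'),
   (84,SX), (84,SX'), (85,ST), (85,SY), (85,SX), (86,ST), (86,SX'), (87,SY), (87,SX), (89,ST),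
   (89,SY), (89,SX), (90,SY), (90,SX), (92,ST), (92,SX'), (93,ST), (93,SY), (93,SX), (94,ST),
   (95,SX), (95,SX'), (96,SY), (96,SX), (97,SX'), (98,ST), (98,SY), (98,SX), (99,ST), (99,SX'),
   (100,SX), (100,SX'), (101,SX), (101,SX'), (102,SY), (102,SX), (103,SY), (103,SX'), (105,ST),
   (105,SX'), (106,SX), (106,SX'), (108,ST), (108,SY), (108,SX'), (110,ST), (110,SY), (111,SX),
   (112,ST), (112,SY), (113,ST), (113,SX), (115,ST), (115,SX), (116,ST), (116,SY), (116,SX'),
   (117,SX), (117,SX'), (118,SY), (118,SX), (119,SX'), (120,ST), (120,SX'), (121,SX), (122,ST),
   (122,SX), (123,ST), (123,SY), (123,SX'), (125,SY), (125,SX), (127,SX), (128,ST), (128,SY),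
   (128,SX'), (129,ST), (129,SX), (131,SX), (132,SX'), (133,ST), (133,SX), (134,SX), (134,SX'),
   (135,SX), (136,ST), (136,SX'), (137,ST), (137,SY), (137,SX), (139,ST), (140,SY), (140,SX),
   (140,SX'), (142,ST), (142,SY), (143,ST), (143,SX), (144,ST), (144,SX'), (145,SY), (146,SX'),
   (147,ST), (147,SX), (151,ST), (152,SY), (155,SX), (156,ST), (157,SX), (157,SX'), (158,ST),
   (159,SY), (159,SX), (159,SX'), (160,SX'), (161,SY), (161,SX), (163,SX), (164,SX'), (165,SX'),
   (166,SY), (166,SX), (167,ST), (167,SY), (168,SX), (170,ST), (171,SX), (171,SX'), (172,ST),
   (173,ST), (173,SX), (176,SX'), (178,ST), (180,ST), (181,SX), (181,SX'), (187,ST), (187,SY),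
   (190,SY), (191,SY), (191,SX), (191,SX'), (193,SX'), (194,SY), (195,SX'), (196,ST), (196,SX),
   (197,SY), (197,SX'), (199,SX'), (200,SY), (200,SX), (204,SX'), (207,SX), (208,SX'), (212,ST),
   (215,ST), (216,SY), (216,SX), (219,SX'), (220,SX), (221,ST), (222,ST), (223,SX'), (224,SY),
   (227,ST), (229,ST), (229,SY), (230,SY), (232,ST), (234,SX'), (237,SY), (237,SX), (237,SX'),
   (240,SX), (242,SX'), (244,ST), (255,SX), (256,SX'), (257,SY), (259,ST), (260,ST), (261,ST),
   (262,ST), (269,SX), (271,SX'), (280,SX), (296,ST), (4,SX'), (331,SX'), (331,ST), (7,SX),
   (332,ST), (333,SX), (333,SX'), (16,SY), (15,ST), (11,SY), (335,SX'), (335,SX), (336,SY),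
   (336,ST), (336,SX), (337,SY), (337,ST), (337,SX'), (30,SY), (338,SX), (338,ST), (339,SY),
   (28,SX), (27,SX'), (26,SX'), (341,SY), (341,SX'), (341,ST), (342,SY), (342,ST), (342,SX),
   (343,SX'), (343,ST), (344,SX), (344,SX'), (345,SX), (347,SX'), (347,SX), (348,SX'), (54,SY),
   (349,SX), (349,SX'), (350,SX), (351,SX'), (351,SX), (51,SX), (354,ST), (36,SY), (37,SX'),
   (38,SX), (38,SX'), (47,ST), (356,ST), (357,SX'), (358,SX), (358,SX'), (359,SX'), (360,SX),
   (361,ST), (364,SY), (364,SX), (364,ST), (365,SY), (365,SX'), (366,ST), (367,ST), (368,SX),
   (94,SY), (94,SX'), (370,SX), (370,SX'), (371,ST), (374,SY), (374,SX'), (374,ST), (375,SY),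
   (375,SX), (91,SX), (92,SY), (88,SX'), (88,ST), (86,SY), (377,SX'), (68,SY), (69,SY), (63,ST),
   (64,SY), (378,SX'), (380,SX), (380,ST), (381,ST), (81,SX'), (382,SX), (382,SX'), (79,SY),
   (80,SY), (385,SX), (386,SX'), (386,SY), (386,ST), (388,ST), (388,SX), (389,SX), (390,SX'),
   (390,ST), (391,SY), (391,ST), (392,SX), (393,SX), (394,SY), (394,ST), (395,SX'), (395,SX),
   (396,SX'), (396,SX), (397,SY), (397,SX), (160,ST), (160,SX), (161,ST), (162,SX), (398,SX),
   (398,SX'), (399,SY), (399,SX'), (400,ST), (401,SX'), (402,SX), (402,SX'), (163,ST), (163,SY),
   (164,ST), (164,SY), (403,SX), (403,ST), (404,SX'), (404,SY), (404,ST), (405,SX), (405,SX'),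
   (406,SX'), (407,ST), (407,SY), (156,SY), (156,SX), (155,SX'), (408,SY), (157,SY), (409,SX),
   (158,SY), (152,SX'), (152,SX), (153,SX), (153,SX'), (410,SX'), (411,SX'), (146,SX), (146,ST),
   (145,SX'), (145,SX), (143,SY), (149,SX'), (149,SY), (148,SX'), (148,SY), (412,SX), (413,ST),
   (414,SX'), (120,SY), (119,SX), (119,SY), (415,SX), (122,SY), (416,SX'), (109,SX), (107,ST),
   (418,ST), (111,SX'), (103,SX), (113,SY), (114,SX'), (114,SY), (419,SY), (420,SX), (420,SX'),
   (421,SX), (422,SX'), (423,SY), (423,ST), (424,SY), (134,SY), (427,SX), (427,SY), (427,ST),
   (428,SX'), (428,ST), (429,ST), (430,SX'), (430,SX), (431,SX), (433,SY), (434,ST), (435,SX'),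
   (435,SX), (436,ST), (437,SX), (438,SY), (438,ST), (438,SX), (439,SY), (440,ST), (441,SX'),
   (442,SY), (443,SY), (444,SY), (445,SX), (445,ST), (257,SX'), (448,SX'), (448,SX), (449,SX),
   (450,SX'), (450,SY), (255,SY), (256,ST), (256,SY), (451,SX), (452,SY), (453,SX'), (453,ST),
   (455,SY), (456,SX), (456,SX'), (457,SX'), (458,SY), (458,SX), (459,SY), (460,SX), (461,SX'),
   (260,SY), (462,SX), (462,SY), (462,SX'), (464,SX), (464,SY), (465,SX'), (465,SX), (467,ST),
   (467,SX), (468,SX'), (469,ST), (469,SY), (470,SY), (470,ST), (471,SY), (472,SX), (250,SX),
   (474,SX'), (474,SX), (475,SX), (475,SY), (249,ST), (249,SX), (476,SX'), (251,SX), (251,SY),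
   (252,SX'), (252,SY), (252,ST), (478,SX), (479,SX), (479,SY), (480,ST), (253,SX), (253,SX'),
   (481,SY), (481,ST), (481,SX'), (482,SX), (482,SY), (248,SX), (485,SX'), (486,SX'), (247,SY),
   (247,SX), (488,SX'), (489,SX'), (490,SX), (490,SY), (245,SX), (239,SY), (240,ST), (493,SX'),
   (493,SX), (494,SX'), (495,SX'), (497,SX'), (498,SY), (200,ST), (201,SX'), (205,SX), (205,SX'),
   (206,ST), (500,SX), (503,ST), (208,SX), (209,ST), (210,SX'), (210,SY), (211,SX'), (504,ST),
   (505,SX), (188,SY), (188,SX'), (508,ST), (509,SX), (180,SY), (175,SX), (510,SX'), (193,SX),
   (194,ST), (514,SX), (514,ST), (516,SX), (230,SX), (231,SX'), (519,SX), (519,SX'), (226,SY),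
   (225,SY), (225,SX), (228,SX'), (228,SX), (523,ST), (524,SX), (524,SX'), (525,ST), (527,SX'),
   (528,ST), (529,SX), (530,ST), (530,SX), (532,SY), (533,SY), (536,SX), (537,SX'), (539,SX),
   (542,SY), (542,SX'), (542,ST), (546,SX), (547,SX), (548,ST), (549,SY), (550,SY), (320,SX),
   (555,SY), (321,SX'), (557,SX), (562,SY), (562,ST), (563,SY), (566,ST), (568,SX), (570,ST),
   (571,SY), (576,SY), (577,SY), (578,SX), (579,ST), (580,ST), (581,SY), (586,ST), (587,SX),
   (587,SY), (588,SY), (590,SY), (591,SX'), (593,SX), (594,SX'), (595,SX), (596,SX), (597,SX'),
   (598,SX), (598,ST), (598,SX'), (601,ST), (603,SX), (604,SX), (605,SX'), (605,SY), (606,ST),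
   (606,SX'), (608,SX'), (609,SX), (609,SY), (610,SX'), (611,SX), (615,SX), (616,SY), (617,SX'),
   (618,SX), (620,ST), (626,ST), (627,ST), (629,SY), (293,SX'), (294,SX), (630,SX'), (630,SY),
   (631,SY), (632,ST), (632,SY), (634,SY), (634,SX), (297,SY), (636,SX), (638,SY), (639,SX),
   (640,SX'), (642,SY), (642,SX), (644,SY), (645,SX'), (646,SX), (276,SY), (278,SY), (277,SY),
   (648,SY), (274,SX'), (650,SX), (285,SY), (651,SX), (651,SY), (653,SX), (654,SX), (656,ST),
   (657,SY), (658,SY), (660,SX'), (662,SY), (663,SY), (664,SX), (666,SX'), (667,SX)]"

definition c330_scans :: "(int \<times> nat) list" where
  "c330_scans = [
   (2,4), (4,1), (4,4), (6,4), (7,0), (1,3), (14,2), (12,4), (8,1), (14,4), (9,1), (18,1),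
   (338,4), (15,4), (28,0), (3,3), (21,5), (10,3), (10,4), (10,1), (21,0), (12,3), (21,3),
   (23,1), (343,4), (73,3), (348,0), (30,4), (30,1), (28,4), (51,0), (51,1), (39,1), (19,7),
   (55,1), (37,4), (32,3), (48,4), (47,4), (356,4), (357,0), (362,1), (343,2), (350,1), (350,3),
   (58,4), (356,3), (73,1), (42,6), (126,1), (387,2), (76,4), (83,1), (49,1), (53,4), (89,0),
   (88,4), (41,4), (63,1), (63,4), (139,3), (64,5), (35,3), (82,4), (36,1), (65,0), (89,3),
   (126,4), (97,4), (98,5), (44,3), (56,3), (77,1), (57,4), (59,3), (99,0), (419,3), (17,3),
   (160,4), (160,1), (94,1), (399,0), (16,3), (141,4), (142,0), (108,1), (91,1), (92,4), (154,1),
   (89,4), (153,1), (484,3), (151,1), (146,1), (146,4), (85,1), (145,7), (161,3), (84,1),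
   (149,0), (486,1), (86,4), (120,0), (69,4), (104,4), (62,1), (64,1), (39,3), (418,4), (102,0),
   (209,3), (66,1), (18,3), (114,1), (419,1), (102,3), (81,1), (422,0), (78,1), (424,1), (79,4),
   (134,7), (135,1), (136,0), (42,3), (220,5), (129,3), (130,4), (218,0), (217,4), (214,1),
   (167,1), (266,0), (169,4), (170,4), (147,5), (85,3), (393,1), (440,4), (118,3), (257,1),
   (322,0), (161,4), (398,1), (129,1), (453,4), (259,1), (399,2), (54,2), (415,1), (206,3),
   (118,4), (457,0), (131,1), (387,3), (220,3), (459,1), (260,1), (164,4), (141,1), (238,4),
   (238,1), (471,1), (474,1), (409,1), (480,4), (485,0), (151,4), (244,4), (444,4), (242,0),
   (569,1), (461,6), (143,4), (240,4), (149,1), (493,1), (148,1), (498,1), (628,0), (146,3),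
   (203,2), (84,2), (223,4), (480,3), (526,4), (304,4), (192,2), (112,1), (131,3), (588,3),
   (23,3), (196,3), (182,2), (177,0), (108,3), (199,1), (212,1), (273,5), (173,3), (201,1),
   (199,4), (199,0), (122,1), (116,3), (123,4), (123,1), (198,4), (184,4), (110,4), (192,4),
   (178,4), (510,2), (113,1), (194,1), (137,4), (137,1), (133,1), (296,3), (224,4), (227,4),
   (523,4), (525,4), (528,7), (167,4), (262,1), (264,0), (264,1), (270,1), (368,3), (549,1),
   (254,1), (256,4), (321,0), (219,7), (566,4), (557,3), (161,5), (317,4), (313,1), (234,1),
   (280,4), (280,1), (235,4), (588,1), (52,3), (590,5), (255,3), (587,3), (591,3), (708,3),
   (137,3), (661,5), (225,3), (594,0), (596,1), (597,0), (598,4), (252,1), (289,4), (606,4),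
   (481,1), (609,0), (648,3), (266,3), (320,3), (616,1), (618,0), (626,7), (627,7), (200,4),
   (737,3), (294,1), (630,0), (630,1), (205,1), (632,1), (675,3), (640,0), (747,3), (112,3),
   (644,1), (646,1), (180,4), (278,1), (181,1), (648,5), (115,3), (175,3), (274,0), (727,1),
   (634,3), (118,5), (650,3), (297,4), (244,3), (194,4), (653,7), (380,3), (156,5), (90,3),
   (310,4), (225,1), (662,1), (228,1), (666,0), (129,6), (150,3), (775,1), (773,0), (53,3),
   (299,3), (679,1), (680,4), (611,1), (723,2), (78,3), (100,6), (174,7), (120,3), (136,3),
   (270,3), (318,3), (190,3), (152,3), (61,3), (190,6), (34,5), (21,7), (250,6), (119,3),
   (320,6), (70,6), (310,3), (236,6), (234,7), (29,3), (748,5), (598,6), (88,3), (155,5),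
   (165,6), (330,1), (330,7), (155,2), (197,6), (279,3), (230,3), (75,5), (291,7), (230,6),
   (269,5), (241,5), (316,3), (162,5), (205,3), (327,5), (328,6), (295,5), (233,5)]"

lemma enumerates_7: "enumerates (\<lambda>d. d \<le> idx 7) (nums 7 num.One) W1 [] c7_defs c7_scans"
  by code_simp

lemma enumerates_24: "enumerates (\<lambda>d. d \<le> idx 24) (nums 24 num.One) W2 W1 c24_defs c24_scans"
  by code_simp

lemma enumerates_8: "enumerates (\<lambda>d. d \<in> set c8_reps) c8_reps W3 W2 c8_defs c8_scans"
  by code_simp

lemma enumerates_330: "enumerates (\<lambda>d. d \<le> idx 330) (nums 330 num.One) W4 W3 c330_defs c330_scans"
  by code_simp

section \<open>Presented groups\<close>

lemma reduced_Nil [simp]: "reduced []"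
  by (simp add: reduced_def)

lemma reduced_Cons:
  "reduced (a # w) \<longleftrightarrow> reduced w \<and> (w = [] \<or> \<not> (fst a = fst (hd w) \<and> snd a \<noteq> snd (hd w)))"
proof -
  have all: "(\<forall>i. Q i) \<longleftrightarrow> Q 0 \<and> (\<forall>i. Q (Suc i))" for Q :: "nat \<Rightarrow> bool"
    using not0_implies_Suc by metis
  show ?thesis unfolding reduced_def by (subst all) (cases w; auto)
qed

lemma reduced_red_step: "reduced w \<Longrightarrow> reduced (red_step a w)"
  by (cases w) (auto simp: red_step_def reduced_Cons)

text \<open>The core of van der Waerden's argument: letters act on reduced words, and inverse
  letters act as inverse maps. Associativity of the free group then comes from composition of maps
  instead of confluence of cancellations.\<close>

lemma red_step_cancel: "reduced w \<Longrightarrow> red_step (i, b) (red_step (i, \<not> b) w) = w"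
  by (cases w) (auto simp: red_step_def reduced_Cons split: list.splits)

lemma foldr_red_step_reduced: "reduced v \<Longrightarrow> reduced (foldr red_step u v)"
  by (induction u) (auto simp: reduced_red_step)

lemma reduced_reduce: "reduced (reduce w)"
  by (simp add: reduce_def foldr_red_step_reduced)

lemma reduce_reduced: "reduced w \<Longrightarrow> reduce w = w"
proof (induction w)
  case (Cons a w)
  then have "reduce (a # w) = red_step a w" by (simp add: reduce_def reduced_Cons)
  with Cons.prems show ?case by (cases w) (auto simp: red_step_def reduced_Cons)
qed (simp add: reduce_def)

text \<open>If \<open>a\<close> cancels the first letter of \<open>u\<close>, the two corresponding
  maps are inverse to each other, so dropping the pair does not change the action of the
  word.\<close>

lemma foldr_red_step_step:
  "reduced v \<Longrightarrow> foldr red_step (red_step a u) v = red_step a (foldr red_step u v)"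
proof (cases u)
  case (Cons b u')
  assume v: "reduced v"
  show ?thesis
  proof (cases "fst a = fst b \<and> snd a \<noteq> snd b")
    case True
    then have b: "b = (fst a, \<not> snd a)" by (cases b) auto
    have "red_step a (red_step b (foldr red_step u' v)) = foldr red_step u' v"
      using red_step_cancel[OF foldr_red_step_reduced[OF v], of "fst a" "snd a" u'] by (simp add: b)
    moreover have "red_step a u = u'" using True by (simp add: Cons red_step_def)
    ultimately show ?thesis by (simp add: Cons)
  next
    case False
    then have "red_step a u = a # u" by (auto simp: Cons red_step_def)
    then show ?thesis by simp
  qed
qed (simp add: red_step_def)

lemma reduce_append: "reduce (u @ v) = foldr red_step u (reduce v)"
  by (simp add: reduce_def)

lemma reduce_append_left: "reduce (reduce u @ v) = reduce (u @ v)"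
proof -
  have "foldr red_step (reduce u) r = foldr red_step u r" if "reduced r" for r
  proof (induction u)
    case (Cons a u)
    then show ?case using foldr_red_step_step[OF that] by (simp add: reduce_def)
  qed (simp add: reduce_def)
  then show ?thesis by (simp add: reduce_append reduced_reduce)
qed

lemma reduce_append_right: "reduce (u @ reduce v) = reduce (u @ v)"
  by (simp add: reduce_append reduce_reduced reduced_reduce)

lemma set_reduce: "set (reduce w) \<subseteq> set w"
proof (induction w)
  case (Cons a w)
  have "set (red_step a v) \<subseteq> insert a (set v)" for v
    by (auto simp: red_step_def split: list.splits if_splits)
  with Cons show ?case by (fastforce simp: reduce_def)
qed (simp add: reduce_def)

lemma reduce_winv_left: "reduce (winv w @ w) = []"
proof (induction w)
  case (Cons a w)
  obtain i b where a: "a = (i, b)" by force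
  have "reduce (winv (a # w) @ a # w) = reduce (winv w @ reduce ((i, \<not> b) # (i, b) # w))"
    by (simp add: a winv_def reduce_append_right[of _ "_ # _"])
  also have "reduce ((i, \<not> b) # (i, b) # w) = reduce w"
    using red_step_cancel[of "reduce w" i "\<not> b"] reduced_reduce[of w] by (simp add: reduce_def)
  finally show ?case using Cons by (simp add: reduce_append_right)
qed (simp add: reduce_def winv_def)

lemma fst_winv: "fst ` set (winv w) = fst ` set w"
  by (simp add: winv_def image_image case_prod_beta)

abbreviation words :: "nat set \<Rightarrow> word set" where "words S \<equiv> {w. fst ` set w \<subseteq> S}"

lemma reduce_in_words: "w \<in> words S \<Longrightarrow> reduce w \<in> carrier (free_grp_on S)"
  using set_reduce[of w] by (auto simp: free_grp_on_def reduced_reduce)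

lemma free_group: "group (free_grp_on S)"
proof (rule groupI)
  fix u v w
  assume "u \<in> carrier (free_grp_on S)" "v \<in> carrier (free_grp_on S)" "w \<in> carrier (free_grp_on S)"
  then show "u \<otimes>\<^bsub>free_grp_on S\<^esub> v \<otimes>\<^bsub>free_grp_on S\<^esub> w = u \<otimes>\<^bsub>free_grp_on S\<^esub> (v \<otimes>\<^bsub>free_grp_on S\<^esub> w)"
    by (simp add: free_grp_on_def reduce_append_left reduce_append_right)
  show "u \<otimes>\<^bsub>free_grp_on S\<^esub> v \<in> carrier (free_grp_on S)"
    using \<open>u \<in> _\<close> \<open>v \<in> _\<close> reduce_in_words[of "u @ v" S] by (auto simp: free_grp_on_def)
  show "\<one>\<^bsub>free_grp_on S\<^esub> \<otimes>\<^bsub>free_grp_on S\<^esub> u = u"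
    using \<open>u \<in> _\<close> by (simp add: free_grp_on_def reduce_reduced)
  have "reduce (winv u) \<in> carrier (free_grp_on S)"
    using \<open>u \<in> _\<close> by (intro reduce_in_words) (auto simp: free_grp_on_def fst_winv)
  then show "\<exists>v\<in>carrier (free_grp_on S). v \<otimes>\<^bsub>free_grp_on S\<^esub> u = \<one>\<^bsub>free_grp_on S\<^esub>"
    by (rule bexI[rotated]) (simp add: free_grp_on_def reduce_append_left reduce_winv_left)
qed (simp add: free_grp_on_def)

section \<open>Evaluation of words in a group\<close>

definition ev :: "('b, 'c) monoid_scheme \<Rightarrow> (nat \<Rightarrow> 'b) \<Rightarrow> word \<Rightarrow> 'b" where
  "ev H e w = foldr (\<lambda>(i, b) h. (if b then inv\<^bsub>H\<^esub> (e i) else e i) \<otimes>\<^bsub>H\<^esub> h) w \<one>\<^bsub>H\<^esub>"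

lemma ev_Nil [simp]: "ev H e [] = \<one>\<^bsub>H\<^esub>"
  by (simp add: ev_def)

lemma ev_Cons: "ev H e ((i, b) # w) = (if b then inv\<^bsub>H\<^esub> (e i) else e i) \<otimes>\<^bsub>H\<^esub> ev H e w"
  by (simp add: ev_def)

context group
begin

lemma ev_closed: "e ` S \<subseteq> carrier G \<Longrightarrow> w \<in> words S \<Longrightarrow> ev G e w \<in> carrier G"
proof (induction w)
  case (Cons a w)
  then show ?case by (cases a) (auto simp: ev_Cons)
qed simp

lemma ev_append:
  "e ` S \<subseteq> carrier G \<Longrightarrow> u \<in> words S \<Longrightarrow> v \<in> words S \<Longrightarrow> ev G e (u @ v) = ev G e u \<otimes> ev G e v"
proof (induction u)
  case Nil
  then show ?case using ev_closed[of e S v] by simp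
next
  case (Cons a u)
  then show ?case
    using ev_closed[of e S v] ev_closed[of e S u] by (cases a) (auto simp: ev_Cons m_assoc)
qed

lemma ev_reduce: "e ` S \<subseteq> carrier G \<Longrightarrow> w \<in> words S \<Longrightarrow> ev G e (reduce w) = ev G e w"
proof (induction w)
  case (Cons a w)
  obtain i b where a: "a = (i, b)" by force
  have w: "w \<in> words S" and i: "e i \<in> carrier G" using Cons.prems by (auto simp: a)
  have "ev G e (red_step a v) = ev G e (a # v)" if "v \<in> words S" for v
  proof (cases v)
    case (Cons c r)
    obtain j d where c: "c = (j, d)" by force
    have "ev G e r \<in> carrier G" using that Cons \<open>e ` S \<subseteq> _\<close> by (intro ev_closed) auto
    then show ?thesis
      using i by (auto simp: red_step_def Cons a c ev_Cons m_assoc[symmetric])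
  qed (simp add: red_step_def)
  moreover have "reduce w \<in> words S" using w set_reduce[of w] by auto
  ultimately have "ev G e (red_step a (reduce w)) = ev G e (a # reduce w)" by blast
  then show ?case using Cons.IH[OF Cons.prems(1) w] by (simp add: a ev_Cons reduce_def)
qed (simp add: reduce_def)

lemma ev_hom: "e ` S \<subseteq> carrier G \<Longrightarrow> ev G e \<in> hom (free_grp_on S) G"
proof (rule homI)
  assume e: "e ` S \<subseteq> carrier G"
  fix u v assume "u \<in> carrier (free_grp_on S)" "v \<in> carrier (free_grp_on S)"
  then have uv: "u \<in> words S" "v \<in> words S" by (auto simp: free_grp_on_def)
  then show "ev G e u \<in> carrier G" using ev_closed[OF e] by blast
  have "u @ v \<in> words S" using uv by auto
  then show "ev G e (u \<otimes>\<^bsub>free_grp_on S\<^esub> v) = ev G e u \<otimes> ev G e v"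
    using ev_reduce[OF e] ev_append[OF e uv] by (simp add: free_grp_on_def)
qed

end

section \<open>The quotient by the relators and its universal property\<close>

locale presentation =
  fixes S :: "nat set" and R :: "word set"
  assumes relators: "R \<subseteq> words S"
begin

abbreviation "F \<equiv> free_grp_on S"
abbreviation "N \<equiv> normal_closure F (reduce ` R)"
abbreviation "PG \<equiv> presented_group S R"

sublocale F: group F by (rule free_group)

lemma relators_F: "reduce ` R \<subseteq> carrier F"
  using relators reduce_in_words by blast

lemma normal: "N \<lhd> F"
  unfolding normal_closure_def
proof (rule F.normal_generateI)
  show "{inv\<^bsub>F\<^esub> g \<otimes>\<^bsub>F\<^esub> r \<otimes>\<^bsub>F\<^esub> g |g r. g \<in> carrier F \<and> r \<in> reduce ` R} \<subseteq> carrier F"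
    using relators_F by blast
  fix h g
  assume "h \<in> {inv\<^bsub>F\<^esub> g \<otimes>\<^bsub>F\<^esub> r \<otimes>\<^bsub>F\<^esub> g |g r. g \<in> carrier F \<and> r \<in> reduce ` R}" and g: "g \<in> carrier F"
  then obtain k r where kr: "h = inv\<^bsub>F\<^esub> k \<otimes>\<^bsub>F\<^esub> r \<otimes>\<^bsub>F\<^esub> k" "k \<in> carrier F" "r \<in> reduce ` R" by blast
  then have "r \<in> carrier F" using relators_F by blast
  \<comment> \<open>The generators of \<open>N\<close> have the form k^-1 r k, whereas the normality
    criterion conjugates as g h g^-1; this is why \<open>g\<close> enters inverted.\<close>
  then have "g \<otimes>\<^bsub>F\<^esub> h \<otimes>\<^bsub>F\<^esub> inv\<^bsub>F\<^esub> g
      = inv\<^bsub>F\<^esub> (k \<otimes>\<^bsub>F\<^esub> inv\<^bsub>F\<^esub> g) \<otimes>\<^bsub>F\<^esub> r \<otimes>\<^bsub>F\<^esub> (k \<otimes>\<^bsub>F\<^esub> inv\<^bsub>F\<^esub> g)"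
    using kr g by (simp add: F.inv_mult_group F.m_assoc)
  moreover have "k \<otimes>\<^bsub>F\<^esub> inv\<^bsub>F\<^esub> g \<in> carrier F" using kr g by simp
  ultimately show "g \<otimes>\<^bsub>F\<^esub> h \<otimes>\<^bsub>F\<^esub> inv\<^bsub>F\<^esub> g
      \<in> {inv\<^bsub>F\<^esub> g \<otimes>\<^bsub>F\<^esub> r \<otimes>\<^bsub>F\<^esub> g |g r. g \<in> carrier F \<and> r \<in> reduce ` R}"
    using kr(3) by blast
qed

sublocale N: normal N F by (rule normal)

lemma PG_eq: "PG = F Mod N"
  by (simp add: presented_group_def)

lemma PG_group: "group PG"
  unfolding PG_eq by (rule N.factorgroup_is_group)

definition cls :: "nat \<Rightarrow> word set" where "cls i = N #>\<^bsub>F\<^esub> gen i"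

lemma gen_F: "i \<in> S \<Longrightarrow> gen i \<in> carrier F"
  by (auto simp: gen_def free_grp_on_def reduced_def)

lemma cls_closed: "cls ` S \<subseteq> carrier PG"
  using gen_F by (auto simp: cls_def PG_eq FactGroup_def intro!: F.rcosetsI N.subset)

text \<open>Translates cosets into values of words at the generating classes. Afterwards the
  presented group is handled through \<open>ev\<close> alone, like any other group with three named
  elements.\<close>

lemma ev_cls: "w \<in> words S \<Longrightarrow> ev PG cls w = N #>\<^bsub>F\<^esub> reduce w"
proof (induction w)
  case Nil
  have "reduce [] = \<one>\<^bsub>F\<^esub>" by (simp add: reduce_def free_grp_on_def)
  then have "N #>\<^bsub>F\<^esub> reduce [] = N" using F.coset_mult_one[OF N.subset] by simp
  then show ?case by (simp add: PG_eq)
next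
  case (Cons a w)
  obtain i b where a: "a = (i, b)" by force
  have i: "i \<in> S" and w: "w \<in> words S" using Cons.prems by (auto simp: a)
  have hom: "(\<lambda>v. N #>\<^bsub>F\<^esub> v) \<in> hom F PG" unfolding PG_eq by (rule N.r_coset_hom_Mod)
  have inv: "inv\<^bsub>F\<^esub> (gen i) = [(i, True)]"
    by (rule F.inv_equality) (auto simp: free_grp_on_def gen_def reduced_def reduce_def red_step_def i)
  have "group_hom F PG (\<lambda>v. N #>\<^bsub>F\<^esub> v)"
    by (intro group_hom.intro group_hom_axioms.intro F.is_group PG_group hom)
  from group_hom.hom_inv[OF this gen_F[OF i]] have "inv\<^bsub>PG\<^esub> (cls i) = N #>\<^bsub>F\<^esub> [(i, True)]"
    unfolding cls_def inv by (rule sym)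
  moreover have "cls i = N #>\<^bsub>F\<^esub> [(i, False)]" by (simp only: cls_def gen_def)
  ultimately have "(if b then inv\<^bsub>PG\<^esub> (cls i) else cls i) = N #>\<^bsub>F\<^esub> [(i, b)]"
    by (cases b) simp_all
  moreover have "[(i, b)] \<in> carrier F" by (auto simp: free_grp_on_def reduced_def i)
  then have "(N #>\<^bsub>F\<^esub> [(i, b)]) \<otimes>\<^bsub>PG\<^esub> (N #>\<^bsub>F\<^esub> reduce w) = N #>\<^bsub>F\<^esub> ([(i, b)] \<otimes>\<^bsub>F\<^esub> reduce w)"
    using hom_mult[OF hom] reduce_in_words[OF w] by metis
  moreover have "[(i, b)] \<otimes>\<^bsub>F\<^esub> reduce w = reduce (a # w)"
    using reduce_append_right[of "[(i, b)]" w] by (simp add: free_grp_on_def a)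
  ultimately show ?case using Cons.IH[OF w] by (simp add: a ev_Cons)
qed

lemma ev_relator: "r \<in> R \<Longrightarrow> ev PG cls r = \<one>\<^bsub>PG\<^esub>"
proof -
  assume r: "r \<in> R"
  then have rF: "reduce r \<in> carrier F" using relators_F by blast
  \<comment> \<open>Exhibits the relator as its own conjugate by 1, the form required of a generator
    of \<open>N\<close>.\<close>
  have "inv\<^bsub>F\<^esub> \<one>\<^bsub>F\<^esub> \<otimes>\<^bsub>F\<^esub> reduce r \<otimes>\<^bsub>F\<^esub> \<one>\<^bsub>F\<^esub> = reduce r" using rF by simp
  then have "reduce r \<in> N"
    unfolding normal_closure_def using r F.one_closed by (intro generate.incl) (smt (verit) imageI mem_Collect_eq)
  then have "N #>\<^bsub>F\<^esub> reduce r = N" by (rule N.rcos_const[OF F.is_group])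
  then show ?thesis using ev_cls relators r by (auto simp: PG_eq)
qed

lemma carrier_PG: "carrier PG = ev PG cls ` words S"
proof
  show "ev PG cls ` words S \<subseteq> carrier PG"
    using group.ev_closed[OF PG_group cls_closed] by blast
  show "carrier PG \<subseteq> ev PG cls ` words S"
  proof
    fix C assume "C \<in> carrier PG"
    then obtain w where "w \<in> carrier F" "C = N #>\<^bsub>F\<^esub> w"
      by (auto simp: PG_eq FactGroup_def RCOSETS_def)
    then have "w \<in> words S" "C = ev PG cls w"
      by (auto simp: ev_cls free_grp_on_def reduce_reduced)
    then show "C \<in> ev PG cls ` words S" by blast
  qed
qed

text \<open>Von Dyck's theorem: the relators, and hence \<open>N\<close>, lie in the kernel of the
  evaluation map on the free group, which therefore factors through the quotient.\<close>

theorem universal_property: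
  assumes "group H" "e ` S \<subseteq> carrier H" and rel: "\<And>r. r \<in> R \<Longrightarrow> ev H e r = \<one>\<^bsub>H\<^esub>"
  obtains h where "h \<in> hom PG H" "\<And>w. w \<in> words S \<Longrightarrow> h (ev PG cls w) = ev H e w"
proof -
  interpret H: group H by fact
  have evh: "ev H e \<in> hom F H" by (rule H.ev_hom) fact
  interpret gh: group_hom F H "ev H e"
    by (simp add: group_hom_def group_hom_axioms_def F.is_group H.is_group evh)
  have ker: "N \<subseteq> kernel F H (ev H e)"
    unfolding normal_closure_def
  proof (rule F.generate_subgroup_incl[OF _ gh.subgroup_kernel], safe)
    fix g r assume g: "g \<in> carrier F" and r: "r \<in> R"
    then have "reduce r \<in> carrier F" using relators_F by blast
    moreover have "ev H e (reduce r) = \<one>\<^bsub>H\<^esub>"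
      using H.ev_reduce[OF assms(2)] relators r rel by auto
    ultimately show "inv\<^bsub>F\<^esub> g \<otimes>\<^bsub>F\<^esub> reduce r \<otimes>\<^bsub>F\<^esub> g \<in> kernel F H (ev H e)"
      using g by (simp add: kernel_def)
  qed
  \<comment> \<open>Evaluation is constant on each coset of \<open>N\<close>, so the image of a
    coset is a singleton.\<close>
  define h where "h C = the_elem (ev H e ` C)" for C
  have h: "h (N #>\<^bsub>F\<^esub> w) = ev H e w" if w: "w \<in> carrier F" for w
  proof -
    have "the_elem (ev H e ` (N #>\<^bsub>F\<^esub> w)) = ev H e w"
    proof (rule the_elem_image_unique)
      show "N #>\<^bsub>F\<^esub> w \<noteq> {}" using F.rcos_self[OF w N.subgroup_axioms] by blast
      fix v assume "v \<in> N #>\<^bsub>F\<^esub> w"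
      then obtain n where "n \<in> N" and v: "v = n \<otimes>\<^bsub>F\<^esub> w" unfolding r_coset_def by blast
      then have "n \<in> kernel F H (ev H e)" using ker by blast
      then have "n \<in> carrier F" "ev H e n = \<one>\<^bsub>H\<^esub>" by (simp_all add: kernel_def)
      then show "ev H e v = ev H e w" unfolding v using w by (simp only: gh.hom_mult gh.hom_closed H.l_one)
    qed
    then show ?thesis by (simp only: h_def)
  qed
  have hev: "h (ev PG cls w) = ev H e w" if "w \<in> words S" for w
    using that by (simp add: ev_cls h reduce_in_words H.ev_reduce[OF assms(2)])
  have "h \<in> hom PG H"
  proof (rule homI)
    fix C D assume "C \<in> carrier PG" "D \<in> carrier PG"
    then obtain u v where uv: "u \<in> words S" "v \<in> words S" "C = ev PG cls u" "D = ev PG cls v"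
      by (auto simp: carrier_PG)
    then show "h C \<in> carrier H" using H.ev_closed[OF assms(2)] by (simp add: hev)
    have "u @ v \<in> words S" using uv by auto
    then show "h (C \<otimes>\<^bsub>PG\<^esub> D) = h C \<otimes>\<^bsub>H\<^esub> h D"
      using uv hev group.ev_append[OF PG_group cls_closed] H.ev_append[OF assms(2)] by metis
  qed
  with hev show thesis using that by blast
qed

end

section \<open>The order of M22\<close>

text \<open>Entries are counted from 1; an index outside the list gives the default \<open>d\<close>, so that
  \<open>perm_of\<close> below fixes all points outside.\<close>
fun entry :: "'a list \<Rightarrow> nat \<Rightarrow> 'a \<Rightarrow> 'a" where
  "entry ps 0 d = d"
| "entry [] (Suc n) d = d"
| "entry (p # ps) (Suc 0) d = p"
| "entry (p # ps) (Suc (Suc n)) d = entry ps (Suc n) d"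

definition perm_of :: "nat list \<Rightarrow> nat \<Rightarrow> nat" where
  "perm_of ps i = entry ps i i"

text \<open>The head acts last, in accordance with the product \<open>f \<circ> g\<close> of the
  symmetric group.\<close>

fun comp_list :: "nat list list \<Rightarrow> nat \<Rightarrow> nat" where
  "comp_list [] i = i"
| "comp_list (ps # ws) i = perm_of ps (comp_list ws i)"

fun agree :: "nat list list \<Rightarrow> nat list list \<Rightarrow> nat list \<Rightarrow> bool" where
  "agree v w [] = True"
| "agree v w (i # is) = (comp_list v i = comp_list w i \<and> agree v w is)"

section \<open>Counting with orbits and stabilisers\<close>

definition perm_monoid :: "('a \<Rightarrow> 'a) set \<Rightarrow> bool" where
  "perm_monoid M \<longleftrightarrow> finite M \<and> id \<in> M \<and> (\<forall>f\<in>M. inj f) \<and> (\<forall>f\<in>M. \<forall>g\<in>M. f \<circ> g \<in> M)"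

definition stab :: "('a \<Rightarrow> 'a) set \<Rightarrow> 'a \<Rightarrow> ('a \<Rightarrow> 'a) set" where
  "stab M b = {f \<in> M. f b = b}"

lemma perm_monoid_stab: "perm_monoid M \<Longrightarrow> perm_monoid (stab M b)"
  by (auto simp: perm_monoid_def stab_def)

text \<open>Choose \<open>r q\<close> in \<open>M\<close> moving \<open>b\<close> to
  \<open>q\<close>. From the product of \<open>r q\<close> and a stabilising \<open>f\<close>, the
  value at \<open>b\<close> recovers \<open>q\<close>, and injectivity of \<open>r q\<close> then
  recovers \<open>f\<close>. Products and cancellation are all that is used, so
  \<open>perm_monoid\<close> does not speak of inverses and passes to stabilisers at once.\<close>

lemma stab_card:
  assumes M: "perm_monoid M" and Q: "Q \<subseteq> (\<lambda>f. f b) ` M"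
  shows "card Q * card (stab M b) \<le> card M"
proof -
  have "\<forall>q\<in>Q. \<exists>f\<in>M. f b = q" using Q by blast
  then obtain r where r: "\<And>q. q \<in> Q \<Longrightarrow> r q \<in> M \<and> r q b = q" by metis
  have "inj_on (\<lambda>(q, f). r q \<circ> f) (Q \<times> stab M b)"
  proof (rule inj_onI, clarify)
    fix q f q' f'
    assume q: "q \<in> Q" "q' \<in> Q" and f: "f \<in> stab M b" "f' \<in> stab M b" and eq: "r q \<circ> f = r q' \<circ> f'"
    have "r q (f b) = r q' (f' b)" using fun_cong[OF eq, of b] by simp
    then have "q = q'" using r[OF q(1)] r[OF q(2)] f by (simp add: stab_def)
    moreover have "inj (r q)" using r[OF q(1)] M by (simp add: perm_monoid_def)
    ultimately show "q = q' \<and> f = f'"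
      using eq by (auto simp: fun_eq_iff inj_def)
  qed
  moreover have "(\<lambda>(q, f). r q \<circ> f) ` (Q \<times> stab M b) \<subseteq> M"
    using r M by (auto simp: perm_monoid_def stab_def)
  ultimately show ?thesis
    using M card_inj_on_le[of _ "Q \<times> stab M b" M] by (simp add: perm_monoid_def card_cartesian_product)
qed

text \<open>An entry \<open>(c, j)\<close> applies generator \<open>j\<close> to a point
  \<open>c\<close> already reached. A bad entry ends the trace, so the list stays inside the orbit
  whatever the certificate says.\<close>

fun trace :: "('a \<Rightarrow> 'a) list \<Rightarrow> ('a \<times> nat) list \<Rightarrow> 'a list \<Rightarrow> 'a list" where
  "trace gs [] acc = acc"
| "trace gs ((c, j) # cs) acc =
     (if c \<in> set acc \<and> j < length gs then trace gs cs ((gs ! j) c # acc) else acc)"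

lemma trace_orbit:
  assumes "perm_monoid M" "set gs \<subseteq> M" "set acc \<subseteq> (\<lambda>f. f b) ` M"
  shows "set (trace gs cs acc) \<subseteq> (\<lambda>f. f b) ` M"
  using assms(2,3)
proof (induction gs cs acc rule: trace.induct)
  case (2 gs c j cs acc)
  show ?case
  proof (cases "c \<in> set acc \<and> j < length gs")
    case True
    then obtain f where "f \<in> M" "c = f b" using "2.prems"(2) by auto
    moreover have "gs ! j \<in> M" using True "2.prems"(1) nth_mem[of j gs] by blast
    ultimately have "(gs ! j) c \<in> (\<lambda>f. f b) ` M"
      using assms(1) by (auto simp: perm_monoid_def intro!: image_eqI[of _ _ "gs ! j \<circ> f"])
    then show ?thesis using 2 True by simp
  qed (use 2 in auto)
qed simp

section \<open>The permutations as lists of images\<close>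

definition l_a :: "nat list" where
  "l_a = [13, 8, 16, 12, 5, 22, 17, 2, 10, 9, 14, 4, 1, 11, 15, 3, 7, 18, 19, 20, 21, 6]"

definition l_b :: "nat list" where
  "l_b = [22, 18, 21, 13, 12, 11, 15, 14, 9, 8, 7, 5, 2, 20, 6, 16, 19, 4, 17, 10, 1, 3]"

definition l_b_inv :: "nat list" where
  "l_b_inv = [21, 13, 22, 18, 12, 15, 11, 10, 9, 20, 6, 5, 4, 8, 7, 16, 19, 2, 17, 14, 3, 1]"

definition l_x :: "nat list" where
  "l_x = [14, 4, 2, 1, 18, 7, 3, 5, 17, 10, 21, 11, 19, 6, 13, 12, 22, 16, 20, 9, 8, 15]"

definition l_x_inv :: "nat list" where
  "l_x_inv = [4, 3, 7, 2, 8, 14, 6, 21, 20, 10, 12, 16, 15, 1, 22, 18, 9, 5, 13, 19, 11, 17]"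

definition l_y :: "nat list" where
  "l_y = [10, 3, 2, 14, 5, 7, 6, 16, 13, 1, 12, 11, 9, 4, 15, 8, 22, 18, 19, 20, 21, 17]"

text \<open>The permutations \<open>l_s1\<close>, ..., \<open>l_s5\<close> generate the successive stabilisers of the points
  8, 6, 7, 12.\<close>
definition l_s1 :: "nat list" where
  "l_s1 = [19, 10, 21, 3, 11, 6, 7, 8, 17, 13, 15, 12, 2, 16, 5, 22, 20, 1, 18, 9, 4, 14]"

definition l_s2 :: "nat list" where
  "l_s2 = [2, 11, 20, 5, 22, 3, 10, 8, 18, 9, 16, 13, 12, 4, 17, 1, 15, 7, 6, 19, 21, 14]"

definition l_s3 :: "nat list" where
  "l_s3 = [22, 11, 10, 18, 2, 6, 20, 8, 5, 1, 16, 15, 21, 4, 17, 9, 13, 7, 3, 14, 12, 19]"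

definition l_s4 :: "nat list" where
  "l_s4 = [12, 2, 15, 17, 9, 6, 7, 8, 5, 10, 16, 1, 13, 21, 3, 11, 4, 19, 18, 22, 14, 20]"

definition l_s5 :: "nat list" where
  "l_s5 = [14, 2, 4, 3, 19, 6, 7, 8, 18, 10, 22, 21, 13, 1, 17, 20, 15, 9, 5, 16, 12, 11]"

lemmas l_defs = l_a_def l_b_def l_b_inv_def l_x_def l_x_inv_def l_y_def l_s1_def l_s2_def l_s3_def l_s4_def l_s5_def

lemma length_l [simp]:
  "length l_a = 22" "length l_b = 22" "length l_b_inv = 22" "length l_x = 22" "length l_x_inv = 22" "length l_y = 22" "length l_s1 = 22" "length l_s2 = 22" "length l_s3 = 22" "length l_s4 = 22" "length l_s5 = 22"
  by (simp_all add: l_defs)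

lemma entry_outside: "i = 0 \<or> length ps < i \<Longrightarrow> entry ps i d = d"
  by (induction ps i d rule: entry.induct) auto

lemma perm_of_outside: "length ps = 22 \<Longrightarrow> i \<notin> {1..22} \<Longrightarrow> perm_of ps i = i"
  by (auto simp: perm_of_def entry_outside not_le)

lemma comp_list_outside:
  "\<forall>ps\<in>set ws. length ps = 22 \<Longrightarrow> i \<notin> {1..22} \<Longrightarrow> comp_list ws i = i"
  by (induction ws) (simp_all add: perm_of_outside)

lemma comp_list_eqI:
  assumes "\<forall>ps\<in>set v. length ps = 22" "\<forall>ps\<in>set w. length ps = 22" "agree v w [1..<23]"
  shows "comp_list v = comp_list w"
proof
  have agree: "comp_list v i = comp_list w i" if "agree v w is" "i \<in> set is" for i "is"
    using that by (induction "is") auto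
  show "comp_list v i = comp_list w i" for i
    using assms agree[OF assms(3), of i] by (cases "i \<in> {1..22}") (auto simp: comp_list_outside)
qed

lemma comp_list_Nil: "comp_list [] = id"
  by auto

lemma comp_list_Cons: "comp_list (ps # ws) = perm_of ps \<circ> comp_list ws"
  by auto

lemma comp_list_single: "perm_of ps = comp_list [ps]"
  by auto

text \<open>The 22 points are written out so that the simplifier can evaluate a product of cycles at
  literal numbers; both sides fix everything else.\<close>

lemma perm_eqI:
  assumes "\<And>i. i \<notin> {1..22} \<Longrightarrow> f i = i" "length ps = 22"
    and "map f [1, 2, 3, 4, 5, 6, 7, 8, 9, 10, 11, 12, 13, 14, 15, 16, 17, 18, 19, 20, 21, 22] = map (perm_of ps) [1, 2, 3, 4, 5, 6, 7, 8, 9, 10, 11, 12, 13, 14, 15, 16, 17, 18, 19, 20, 21, 22]"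
  shows "f = perm_of ps"
proof
  show "f i = perm_of ps i" for i
  proof (cases "i \<in> {1..22}")
    case True
    have "[1..<23] = [1::nat, 2, 3, 4, 5, 6, 7, 8, 9, 10, 11, 12, 13, 14, 15, 16, 17, 18, 19, 20, 21, 22]" by code_simp
    then have "set [1::nat, 2, 3, 4, 5, 6, 7, 8, 9, 10, 11, 12, 13, 14, 15, 16, 17, 18, 19, 20, 21, 22] = {1..<23}" by (metis set_upt)
    with True have "i \<in> set [1, 2, 3, 4, 5, 6, 7, 8, 9, 10, 11, 12, 13, 14, 15, 16, 17, 18, 19, 20, 21, 22]" by auto
    with assms(3) show ?thesis unfolding map_eq_conv by blast
  qed (use assms in \<open>auto simp: perm_of_outside\<close>)
qed

lemma m22_a_eq: "m22_a = perm_of l_a"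
proof (rule perm_eqI)
  have "map (perm_of l_a) [1, 2, 3, 4, 5, 6, 7, 8, 9, 10, 11, 12, 13, 14, 15, 16, 17, 18, 19, 20, 21, 22] = l_a" by code_simp
  then show "map m22_a [1, 2, 3, 4, 5, 6, 7, 8, 9, 10, 11, 12, 13, 14, 15, 16, 17, 18, 19, 20, 21, 22] = map (perm_of l_a) [1, 2, 3, 4, 5, 6, 7, 8, 9, 10, 11, 12, 13, 14, 15, 16, 17, 18, 19, 20, 21, 22]"
    by (simp add: m22_a_def transpose_def l_a_def)
qed (auto simp: m22_a_def id_outside_supp l_a_def)

lemma m22_b_eq: "m22_b = perm_of l_b"
proof (rule perm_eqI)
  have "map (perm_of l_b) [1, 2, 3, 4, 5, 6, 7, 8, 9, 10, 11, 12, 13, 14, 15, 16, 17, 18, 19, 20, 21, 22] = l_b" by code_simp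
  then show "map m22_b [1, 2, 3, 4, 5, 6, 7, 8, 9, 10, 11, 12, 13, 14, 15, 16, 17, 18, 19, 20, 21, 22] = map (perm_of l_b) [1, 2, 3, 4, 5, 6, 7, 8, 9, 10, 11, 12, 13, 14, 15, 16, 17, 18, 19, 20, 21, 22]"
    by (simp add: m22_b_def transpose_def l_b_def)
qed (auto simp: m22_b_def id_outside_supp l_b_def)

text \<open>These words show that all the permutations lie in \<open>M22\<close>. As
  \<open>m22_b\<close> has order 4, its inverse is a positive word too, and closure under
  composition suffices.\<close>

lemma perm_words:
  "perm_of l_b_inv = comp_list [l_b, l_b, l_b]"
  "perm_of l_x = comp_list [l_b_inv, l_a, l_b, l_a, l_b, l_a, l_b_inv, l_a, l_b, l_a, l_b, l_a, l_b, l_a, l_b, l_b, l_a, l_b, l_a, l_b, l_a]"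
  "perm_of l_y = comp_list [l_b_inv, l_a, l_b_inv, l_a, l_b_inv, l_a, l_b, l_a, l_b, l_a, l_b, l_a, l_b, l_b, l_a, l_b_inv, l_a, l_b_inv, l_a, l_b_inv, l_a, l_b, l_a, l_b, l_a, l_b]"
  "perm_of l_s1 = comp_list [l_a, l_b, l_a, l_b_inv, l_a, l_b_inv, l_a, l_b]"
  "perm_of l_s2 = comp_list [l_b, l_a, l_b, l_a, l_b_inv]"
  "perm_of l_s3 = comp_list [l_a, l_b_inv, l_a, l_b, l_a, l_b, l_a, l_b, l_a, l_b_inv]"
  "perm_of l_s4 = comp_list [l_b, l_b, l_a, l_b_inv, l_a, l_b, l_b, l_a, l_b, l_a, l_b, l_b]"
  "perm_of l_s5 = comp_list [l_a, l_b_inv, l_a, l_b_inv, l_a, l_b_inv, l_a, l_b, l_a, l_b, l_a, l_b, l_a]"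
  unfolding comp_list_single by (rule comp_list_eqI, simp, simp, code_simp)+

section \<open>M22 as a permutation group and a lower bound for its order\<close>

lemma M22_group: "group M22"
  and M22_closed: "carrier M22 \<subseteq> {p. p permutes {1..22}}"
proof -
  have ab: "{m22_a, m22_b} \<subseteq> carrier (sym_group 22)"
  proof -
    have cycle: "cycle_of_list cs permutes {1..22}" if "set cs \<subseteq> {1..22}" for cs :: "nat list"
      using cycle_permutes permutes_subset that by blast
    have "m22_a permutes {1..22}" "m22_b permutes {1..22}"
      unfolding m22_a_def m22_b_def by (intro permutes_compose cycle; simp)+
    then show ?thesis by (simp add: sym_group_def)
  qed
  then have sub: "subgroup (carrier M22) (sym_group 22)"
    using group.generate_is_subgroup[OF sym_group_is_group] by (simp add: M22_def)
  then show "carrier M22 \<subseteq> {p. p permutes {1..22}}"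
    using subgroup.subset[OF sub] by (auto simp: sym_group_def)
  show "group M22"
    using group.subgroup_imp_group[OF sym_group_is_group sub] by (simp add: M22_def)
qed

lemma M22_mult [simp]: "f \<otimes>\<^bsub>M22\<^esub> g = f \<circ> g" and M22_one [simp]: "\<one>\<^bsub>M22\<^esub> = id"
  by (simp_all add: M22_def sym_group_def)

lemma perm_monoid_M22: "perm_monoid (carrier M22)"
proof -
  have "finite (carrier M22)"
    using M22_closed finite_permutations[of "{1..22::nat}"] finite_subset by auto
  moreover have "id \<in> carrier M22" "f \<circ> g \<in> carrier M22" if "f \<in> carrier M22" "g \<in> carrier M22" for f g
    using group.is_monoid[OF M22_group] monoid.one_closed monoid.m_closed that by fastforce+
  moreover have "id \<in> carrier M22"
    using group.is_monoid[OF M22_group] monoid.one_closed by fastforce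
  moreover have "inj f" if "f \<in> carrier M22" for f
    using that M22_closed permutes_inj by auto
  ultimately show ?thesis by (auto simp: perm_monoid_def)
qed

lemma comp_list_closed: "\<forall>ps\<in>set ws. perm_of ps \<in> carrier M22 \<Longrightarrow> comp_list ws \<in> carrier M22"
proof (induction ws)
  case Nil
  show ?case unfolding comp_list_Nil using perm_monoid_M22 unfolding perm_monoid_def by blast
next
  case (Cons ps ws)
  then have "perm_of ps \<in> carrier M22" "comp_list ws \<in> carrier M22" by simp_all
  then show ?case unfolding comp_list_Cons using perm_monoid_M22 unfolding perm_monoid_def by blast
qed

lemma ab_M22: "perm_of l_a \<in> carrier M22" "perm_of l_b \<in> carrier M22"
  using generate.incl[of _ "{m22_a, m22_b}" "sym_group 22"]
  by (auto simp: M22_def m22_a_eq[symmetric] m22_b_eq[symmetric])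

lemma b_inv_M22: "perm_of l_b_inv \<in> carrier M22"
  unfolding perm_words by (rule comp_list_closed) (simp add: ab_M22)

lemma perms_M22:
  "perm_of l_x \<in> carrier M22"
  "perm_of l_y \<in> carrier M22"
  "perm_of l_s1 \<in> carrier M22"
  "perm_of l_s2 \<in> carrier M22"
  "perm_of l_s3 \<in> carrier M22"
  "perm_of l_s4 \<in> carrier M22"
  "perm_of l_s5 \<in> carrier M22"
  unfolding perm_words(2-) by (rule comp_list_closed, simp add: ab_M22 b_inv_M22)+

lemma perms_fix:
  "perm_of l_s1 8 = 8" "perm_of l_s1 6 = 6" "perm_of l_s1 7 = 7" "perm_of l_s1 12 = 12"
  "perm_of l_s2 8 = 8"
  "perm_of l_s3 8 = 8" "perm_of l_s3 6 = 6"
  "perm_of l_s4 8 = 8" "perm_of l_s4 6 = 6" "perm_of l_s4 7 = 7"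
  "perm_of l_s5 8 = 8" "perm_of l_s5 6 = 6" "perm_of l_s5 7 = 7"
  by code_simp+

lemma stab_step:
  assumes M: "perm_monoid M" and gs: "set gs \<subseteq> M"
    and tr: "distinct (trace gs cs [b]) \<and> length (trace gs cs [b]) = n" and stab: "k \<le> card (stab M b)"
  shows "n * k \<le> card M"
proof -
  have "id \<in> M" using M by (simp add: perm_monoid_def)
  then have "set [b] \<subseteq> (\<lambda>f. f b) ` M" by (auto intro!: image_eqI[of _ _ id])
  then have "card (set (trace gs cs [b])) * card (stab M b) \<le> card M"
    using stab_card[OF M trace_orbit[OF M gs]] by blast
  moreover have "card (set (trace gs cs [b])) = n"
    using tr distinct_card by blast
  ultimately show ?thesis using stab mult_le_mono2 order_trans by blast
qed

theorem card_M22_ge: "443520 \<le> card (carrier M22)"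
proof -
  define M0 where "M0 = carrier M22"
  define M1 where "M1 = stab M0 8"
  define M2 where "M2 = stab M1 6"
  define M3 where "M3 = stab M2 7"
  define M4 where "M4 = stab M3 12"
  define M5 where "M5 = stab M4 1"
  have M: "perm_monoid M0" "perm_monoid M1" "perm_monoid M2" "perm_monoid M3" "perm_monoid M4" "perm_monoid M5"
    unfolding M5_def M4_def M3_def M2_def M1_def M0_def
    by (intro perm_monoid_stab perm_monoid_M22)+
  \<comment> \<open>Counting the identity is enough, as 22 * 21 * 20 * 16 * 3 is already
    443520.\<close>
  have "1 \<le> card M5"
    using M(6) card_gt_0_iff[of M5] by (auto simp: perm_monoid_def Suc_le_eq)
  then have "3 * 1 \<le> card M4"
    unfolding M5_def
  proof (intro stab_step[OF M(5), where gs = "[perm_of l_s1]"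
      and cs = "[(1, 0), (19, 0)]"])
    show "set [perm_of l_s1] \<subseteq> M4"
      using ab_M22 perms_M22 by (simp add: M4_def M3_def M2_def M1_def M0_def stab_def perms_fix)
    let ?orbit = "trace [perm_of l_s1] [(1, 0), (19, 0)] [1]"
    show "distinct ?orbit \<and> length ?orbit = 3"
      by code_simp
  qed
  then have "3 \<le> card M4" by simp
  \<comment> \<open>The orbit has 16 points and not 19: {2, 6, 7, 8, 10, 13} is the hexad of the
    Steiner system S(3,6,22) through 6, 7, 8, and its points 2, 10, 13 form an orbit of their
    own.\<close>
  then have "16 * 3 \<le> card M3"
    unfolding M4_def
  proof (intro stab_step[OF M(4), where gs = "[perm_of l_s1, perm_of l_s4, perm_of l_s5]"
      and cs = "[(12, 1), (12, 2), (1, 0), (1, 2), (21, 0), (19, 0), (19, 2), (14, 0), (4, 0),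
        (4, 1), (18, 2), (5, 0), (16, 0), (16, 2), (3, 1)]"])
    show "set [perm_of l_s1, perm_of l_s4, perm_of l_s5] \<subseteq> M3"
      using ab_M22 perms_M22 by (simp add: M3_def M2_def M1_def M0_def stab_def perms_fix)
    let ?orbit = "trace [perm_of l_s1, perm_of l_s4, perm_of l_s5] [(12, 1), (12, 2), (1, 0),
        (1, 2), (21, 0), (19, 0), (19, 2), (14, 0), (4, 0), (4, 1), (18, 2), (5, 0), (16, 0),
        (16, 2), (3, 1)] [12]"
    show "distinct ?orbit \<and> length ?orbit = 16"
      by code_simp
  qed
  then have "48 \<le> card M3" by simp
  then have "20 * 48 \<le> card M2"
    unfolding M3_def
  proof (intro stab_step[OF M(3), where gs = "[perm_of l_s1, perm_of l_s3]"
      and cs = "[(7, 1), (20, 0), (20, 1), (9, 0), (9, 1), (14, 0), (14, 1), (17, 1), (5, 0),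
        (5, 1), (16, 0), (4, 0), (4, 1), (13, 1), (11, 0), (2, 0), (22, 1), (18, 0), (21, 1)]"])
    show "set [perm_of l_s1, perm_of l_s3] \<subseteq> M2"
      using ab_M22 perms_M22 by (simp add: M2_def M1_def M0_def stab_def perms_fix)
    let ?orbit = "trace [perm_of l_s1, perm_of l_s3] [(7, 1), (20, 0), (20, 1), (9, 0), (9, 1),
        (14, 0), (14, 1), (17, 1), (5, 0), (5, 1), (16, 0), (4, 0), (4, 1), (13, 1), (11, 0),
        (2, 0), (22, 1), (18, 0), (21, 1)] [7]"
    show "distinct ?orbit \<and> length ?orbit = 20"
      by code_simp
  qed
  then have "960 \<le> card M2" by simp
  then have "21 * 960 \<le> card M1"
    unfolding M2_def
  proof (intro stab_step[OF M(2), where gs = "[perm_of l_s1, perm_of l_s2]"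
      and cs = "[(6, 1), (3, 0), (3, 1), (21, 0), (20, 0), (20, 1), (4, 1), (9, 0), (9, 1),
        (5, 0), (5, 1), (17, 1), (18, 0), (18, 1), (11, 1), (22, 0), (1, 1), (7, 1), (10, 0),
        (13, 1)]"])
    show "set [perm_of l_s1, perm_of l_s2] \<subseteq> M1"
      using ab_M22 perms_M22 by (simp add: M1_def M0_def stab_def perms_fix)
    let ?orbit = "trace [perm_of l_s1, perm_of l_s2] [(6, 1), (3, 0), (3, 1), (21, 0), (20, 0),
        (20, 1), (4, 1), (9, 0), (9, 1), (5, 0), (5, 1), (17, 1), (18, 0), (18, 1), (11, 1),
        (22, 0), (1, 1), (7, 1), (10, 0), (13, 1)] [6]"
    show "distinct ?orbit \<and> length ?orbit = 21"
      by code_simp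
  qed
  then have "20160 \<le> card M1" by simp
  then have "22 * 20160 \<le> card M0"
    unfolding M1_def
  proof (intro stab_step[OF M(1), where gs = "[perm_of l_a, perm_of l_b]"
      and cs = "[(8, 0), (8, 1), (2, 1), (14, 0), (14, 1), (18, 1), (11, 1), (20, 1), (4, 0),
        (4, 1), (7, 0), (7, 1), (10, 0), (12, 1), (13, 0), (17, 1), (15, 1), (1, 1), (22, 1),
        (3, 0), (3, 1)]"])
    show "set [perm_of l_a, perm_of l_b] \<subseteq> M0"
      using ab_M22 perms_M22 by (simp add: M0_def)
    let ?orbit = "trace [perm_of l_a, perm_of l_b] [(8, 0), (8, 1), (2, 1), (14, 0), (14, 1),
        (18, 1), (11, 1), (20, 1), (4, 0), (4, 1), (7, 0), (7, 1), (10, 0), (12, 1), (13, 0),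
        (17, 1), (15, 1), (1, 1), (22, 1), (3, 0), (3, 1)] [8]"
    show "distinct ?orbit \<and> length ?orbit = 22"
      by code_simp
  qed
  then have "443520 \<le> card M0" by simp
  then show ?thesis by (simp add: M0_def)
qed

section \<open>Comparison of the two groups\<close>

context three_generated
begin

lemma wd_pw: "wd (pw n w) = wd w [^] n"
proof (induction n)
  case (Suc n)
  have "wd (pw (Suc n) w) = wd w \<otimes> wd (pw n w)" by (simp add: pw_def wd_append)
  with Suc show ?case by (metis nat_pow_Suc2 wd_closed)
qed (simp add: pw_def)

abbreviation sub :: "sym list list \<Rightarrow> 'a set" where "sub W \<equiv> generate G (wd ` set W)"

lemma sub_subgroup: "subgroup (sub W) G"
  by (rule generate_is_subgroup) auto

lemma sub_card_le:
  assumes "\<And>w. w \<in> set rels \<Longrightarrow> wd w = \<one>" "finite (sub S) \<and> card (sub S) \<le> m"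
    and "enumerates P L W S D C" "num.One \<in> set L" "\<And>d. P d \<Longrightarrow> d \<in> set L"
    and "(\<lambda>w. map sinv (rev w)) ` set W \<subseteq> set W"
  shows "finite (sub W) \<and> card (sub W) \<le> length L * m"
  using generate_card_le[OF sub_subgroup[of S], of m rels S L P "length L" W C D] assms
  by (auto simp: enumerates_def intro: generate.incl)

theorem finite_of_relations:
  assumes R: "\<And>w. w \<in> set rels \<Longrightarrow> wd w = \<one>"
  shows "finite (sub W4) \<and> card (sub W4) \<le> 443520"
proof -
  \<comment> \<open>The chain starts at the trivial group, generated by no words; each bound below
    becomes the \<open>m\<close> of the next step.\<close>
  have "finite (sub []) \<and> card (sub []) \<le> 1"
    by (simp add: generate_empty)
  from sub_card_le[OF R this enumerates_7] le_idx[of 7]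
  have "finite (sub W1) \<and> card (sub W1) \<le> 7"
    by (simp add: W1_def set_nums less_eq_num_def length_nums)
  from sub_card_le[OF R this enumerates_24] le_idx[of 24]
  have "finite (sub W2) \<and> card (sub W2) \<le> 168"
    by (simp add: W2_def set_nums less_eq_num_def length_nums)
  from sub_card_le[OF R this enumerates_8]
  have "finite (sub W3) \<and> card (sub W3) \<le> 1344"
    by (simp add: W3_def c8_reps_def idx_def)
  from sub_card_le[OF R this enumerates_330] le_idx[of 330]
  show ?thesis
    by (simp add: W4_def set_nums less_eq_num_def length_nums)
qed

end

lemma winv_simps: "winv [] = []" "winv ((i, b) # w) = winv w @ [(i, \<not> b)]"
  by (simp_all add: winv_def)

lemmas relator_defs = progenitor_relators_def G_relators_def gx_def gy_def gt_def gen_def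
  wcomm_def wconj_def wpow_def winv_simps numeral_eq_Suc

lemma relators_words: "G_relators \<subseteq> words {0, 1, 2}" "progenitor_relators \<subseteq> words {0, 1, 2}"
  by (auto simp: relator_defs)

interpretation GP: presentation "{0, 1, 2}" G_relators
  by unfold_locales (rule relators_words)

interpretation PP: presentation "{0, 1, 2}" progenitor_relators
  by unfold_locales (rule relators_words)

lemma (in group) ev_wpow:
  "e ` S \<subseteq> carrier G \<Longrightarrow> w \<in> words S \<Longrightarrow> ev G e (wpow w n) = ev G e w [^] n"
proof (induction n)
  case (Suc n)
  have "set (wpow w n) \<subseteq> set w" by (auto simp: wpow_def)
  then have "wpow w n \<in> words S" using Suc.prems by blast
  then have "ev G e (wpow w (Suc n)) = ev G e w \<otimes> ev G e (wpow w n)"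
    using Suc.prems ev_append[of e S w "wpow w n"] by (simp add: wpow_def)
  with Suc show ?case using ev_closed[of e S w] by (metis nat_pow_Suc2)
qed (simp add: wpow_def)

text \<open>Passes from the relators over letters with inversion flags to the symbols of the
  certificates. The relators y^2 and t^2 come first, because they identify an inverted
  \<open>y\<close> or \<open>t\<close> with the plain symbol.\<close>

lemma (in group) card_le_of_G_relators:
  assumes e: "e ` {0, 1, 2} \<subseteq> carrier G"
    and rel: "\<And>r. r \<in> G_relators \<Longrightarrow> ev G e r = \<one>"
    and carrier: "carrier G = ev G e ` words {0, 1, 2}"
  shows "finite (carrier G) \<and> card (carrier G) \<le> 443520"
proof -
  define x y t where "x = e 0" and "y = e 1" and "t = e 2"
  then have xyt: "e 0 = x" "e (Suc 0) = y" "e 2 = t" "e (Suc (Suc 0)) = t"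
    by (simp_all add: numeral_2_eq_2)
  have closed [simp]: "x \<in> carrier G" "y \<in> carrier G" "t \<in> carrier G"
    using e xyt by auto
  have pow: "ev G e w [^] n = \<one>" if "wpow w n \<in> G_relators" "w \<in> words {0, 1, 2}" for w n
    using ev_wpow[OF e that(2)] rel[OF that(1)] by simp
  note word_defs = gx_def gy_def gt_def gen_def wcomm_def wconj_def winv_simps
  have "ev G e gy [^] (2::nat) = \<one>" "ev G e gt [^] (2::nat) = \<one>"
    by (rule pow, simp add: G_relators_def progenitor_relators_def, simp add: word_defs)+
  then have invol: "y \<otimes> y = \<one>" "t \<otimes> t = \<one>"
    by (simp_all add: word_defs ev_Cons xyt numeral_2_eq_2)
  interpret T: three_generated G x y t
    using invol by unfold_locales auto
  have inv: "inv y = y" "inv t = t"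
    using inv_equality invol by auto
  \<comment> \<open>In \<open>(gx @ gy @ wpow gx 2 @ wconj gt gx)\<close> the square of
    \<open>x\<close> meets the leading x^-1 of the conjugate; \<open>rels\<close> contains the word
    after this cancellation.\<close>
  have cancel: "x \<otimes> (inv x \<otimes> z) = z" if "z \<in> carrier G" for z
    using that by (simp add: m_assoc[symmetric])
  note eval = word_defs ev_Cons wpow_def numeral_2_eq_2 inv xyt cancel m_assoc
  have w: "T.wd w = \<one>" if "w \<in> set rels" for w
  proof -
    have "ev G e gx [^] (7::nat) = \<one>"
      "ev G e (gx @ gy) [^] (3::nat) = \<one>"
      "ev G e (wcomm gx gy) [^] (4::nat) = \<one>"
      "ev G e (gy @ wconj gt (wpow gx 2)) [^] (5::nat) = \<one>"
      "ev G e (gx @ gy @ wpow gx 2 @ wconj gt gx) [^] (5::nat) = \<one>"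
      "ev G e (gx @ gt) [^] (8::nat) = \<one>"
      by (rule pow, simp add: G_relators_def progenitor_relators_def,
          simp add: word_defs wpow_def numeral_2_eq_2)+
    then have "T.wd (pw 7 [SX]) = \<one>" "T.wd (pw 3 [SX, SY]) = \<one>"
      "T.wd (pw 4 [SX', SY, SX, SY]) = \<one>"
      "T.wd (pw 5 [SY, SX', SX', ST, SX, SX]) = \<one>"
      "T.wd (pw 5 [SX, SY, SX, ST, SX]) = \<one>"
      "T.wd (pw 8 [SX, ST]) = \<one>"
      by (simp_all add: T.wd_pw eval)
    moreover have "ev G e (wcomm (wconj gt (wpow gx 2)) (gy @ winv gx)) = \<one>"
      "ev G e (wcomm gt gy) = \<one>"
      by (rule rel, simp add: G_relators_def progenitor_relators_def)+
    then have "T.wd [SX', SX', ST, SX, SX, SX, SY, SX', SX', ST, SX, SX, SY, SX'] = \<one>"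
      "T.wd [ST, SY, ST, SY] = \<one>"
      by (simp_all add: eval)
    ultimately show ?thesis using that unfolding rels_def by auto
  qed
  \<comment> \<open>The words in \<open>W4\<close> are the generators and the inverse of
    \<open>x\<close>, so the bound for \<open>T.sub W4\<close> is a bound for the whole
    group.\<close>
  have "ev G e w \<in> T.sub W4" if "w \<in> words {0, 1, 2}" for w
    using that
  proof (induction w)
    case Nil
    then show ?case by (simp add: generate.one)
  next
    case (Cons a w)
    obtain i b where a: "a = (i, b)" by force
    have "T.wd ` set W4 = {x, inv x, y, t}" by (simp add: W4_def)
    moreover have "e i \<in> {x, y, t}" using Cons.prems xyt by (auto simp: a)
    ultimately have "e i \<in> T.wd ` set W4" by auto
    then have "(if b then inv (e i) else e i) \<in> T.sub W4"
      by (auto intro: generate.incl generate.inv simp del: set_simps)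
    moreover have "ev G e w \<in> T.sub W4" using Cons by auto
    ultimately show ?case unfolding a ev_Cons by (rule generate.eng)
  qed
  then have "carrier G \<subseteq> T.sub W4" unfolding carrier by blast
  then show ?thesis
    using T.finite_of_relations[OF w] card_mono finite_subset order_trans by metis
qed

lemma G_pres_bound: "finite (carrier G_pres) \<and> card (carrier G_pres) \<le> 443520"
  unfolding G_pres_def
  by (rule group.card_le_of_G_relators[OF GP.PG_group GP.cls_closed GP.ev_relator GP.carrier_PG])

section \<open>The homomorphisms onto M22\<close>

fun letter_list :: "letter \<Rightarrow> nat list" where
  "letter_list (i, b) = (if i = 0 then (if b then l_x_inv else l_x) else if i = 1 then l_y else l_a)"

text \<open>In \<open>letter_list\<close> only \<open>x\<close> has a separate list for its inverse,
  since the images of \<open>y\<close> and \<open>t\<close> are involutions. Every index from 2 on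
  goes to \<open>l_a\<close>, which makes all values elements of \<open>M22\<close>.\<close>

definition m22_gen :: "nat \<Rightarrow> nat \<Rightarrow> nat" where "m22_gen i = perm_of (letter_list (i, False))"

lemma length_letter_list [simp]: "length (letter_list p) = 22"
  by (cases p) simp

lemma m22_gen_closed: "m22_gen i \<in> carrier M22"
  using ab_M22 perms_M22 by (auto simp: m22_gen_def)

lemma invs:
  "comp_list [l_x_inv, l_x] = comp_list []" "comp_list [l_y, l_y] = comp_list []"
  "comp_list [l_a, l_a] = comp_list []" "comp_list [l_b_inv, l_b] = comp_list []"
  by (rule comp_list_eqI, simp, simp, code_simp)+

lemma m22_gen_inv: "inv\<^bsub>M22\<^esub> (m22_gen i) = perm_of (letter_list (i, True))"
proof (rule group.inv_equality[OF M22_group])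
  show "perm_of (letter_list (i, True)) \<otimes>\<^bsub>M22\<^esub> m22_gen i = \<one>\<^bsub>M22\<^esub>"
    using invs by (simp add: m22_gen_def comp_list_Cons comp_list_Nil del: comp_list.simps)
  \<comment> \<open>The image of \<open>x\<close> has order 7, so its inverse is the sixth power and
    lies in \<open>M22\<close>.\<close>
  have "perm_of l_x_inv = comp_list [l_x, l_x, l_x, l_x, l_x, l_x]"
    unfolding comp_list_single by (rule comp_list_eqI, simp, simp, code_simp)
  then have "perm_of l_x_inv \<in> carrier M22"
    using comp_list_closed[of "[l_x, l_x, l_x, l_x, l_x, l_x]"] perms_M22 by simp
  then show "perm_of (letter_list (i, True)) \<in> carrier M22"
    using ab_M22 perms_M22 by auto
qed (rule m22_gen_closed)

text \<open>Turns an evaluation in \<open>M22\<close> into a product of lists, so that each relation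
  becomes a computation on 22 points.\<close>

lemma ev_M22: "ev M22 m22_gen w = comp_list (map letter_list w)"
proof (induction w)
  case (Cons a w)
  then show ?case
    by (cases a) (simp add: ev_Cons m22_gen_inv comp_list_Cons m22_gen_def[symmetric] del: comp_list.simps letter_list.simps)
qed (simp add: comp_list_Nil del: comp_list.simps)

lemma ev_M22_relators: "r \<in> G_relators \<Longrightarrow> ev M22 m22_gen r = \<one>\<^bsub>M22\<^esub>"
proof -
  have eq: "ev M22 m22_gen r = \<one>\<^bsub>M22\<^esub>" if "agree (map letter_list r) [] [1..<23]" for r
    using comp_list_eqI[OF _ _ that] by (simp add: ev_M22 comp_list_Nil del: comp_list.simps)
  have "\<forall>r\<in>G_relators. ev M22 m22_gen r = \<one>\<^bsub>M22\<^esub>"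
    unfolding G_relators_def progenitor_relators_def ball_Un ball_simps
    by (intro conjI eq TrueI; code_simp)
  then show "r \<in> G_relators \<Longrightarrow> ev M22 m22_gen r = \<one>\<^bsub>M22\<^esub>" by blast
qed

lemma letters_eqI:
  assumes "\<forall>ps\<in>set v. length ps = 22" "agree (map letter_list w) v [1..<23]"
  shows "comp_list (map letter_list w) = comp_list v"
  by (rule comp_list_eqI[OF _ assms]) auto

lemma ev_M22_surj: "carrier M22 \<subseteq> ev M22 m22_gen ` words {0, 1, 2}"
proof
  let ?b = "gx @ gx @ gt @ gx @ gy"
  have t: "gt \<in> words {0, 1, 2}" by (simp add: gt_def gen_def)
  have b: "?b \<in> words {0, 1, 2}" by (auto simp: gx_def gt_def gy_def gen_def)
  \<comment> \<open>The inverse of \<open>m22_b\<close> is its cube, hence the word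
    \<open>?b\<close> repeated three times.\<close>
  have eqs: "comp_list (map letter_list gt) = perm_of l_a" "comp_list (map letter_list ?b) = perm_of l_b"
    "comp_list (map letter_list (?b @ ?b @ ?b)) = perm_of l_b_inv"
    unfolding comp_list_single by (rule letters_eqI, simp, code_simp)+
  have ab: "m22_a \<in> carrier (sym_group 22)" "m22_b \<in> carrier (sym_group 22)"
    "perm_of l_b_inv \<in> carrier (sym_group 22)"
    using ab_M22 b_inv_M22 M22_closed by (auto simp: m22_a_eq m22_b_eq sym_group_def)
  have comp: "perm_of l_a \<circ> perm_of l_a = id" "perm_of l_b_inv \<circ> perm_of l_b = id"
    using invs by (simp_all add: comp_list_Cons comp_list_Nil del: comp_list.simps)
  have inv_ab: "inv\<^bsub>sym_group 22\<^esub> m22_a = perm_of l_a" "inv\<^bsub>sym_group 22\<^esub> m22_b = perm_of l_b_inv"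
    unfolding m22_a_eq m22_b_eq
    by (rule group.inv_equality[OF sym_group_is_group];
        simp add: comp ab[unfolded m22_a_eq m22_b_eq] sym_group_mult sym_group_one)+
  fix f assume "f \<in> carrier M22"
  then have "f \<in> generate (sym_group 22) {m22_a, m22_b}" by (simp add: M22_def)
  then show "f \<in> ev M22 m22_gen ` words {0, 1, 2}"
  proof (induction f rule: generate.induct)
    case one
    show ?case by (rule image_eqI[of _ _ "[]"]) (simp_all add: sym_group_def)
  next
    case (incl h)
    then show ?case
    proof safe
      show "m22_a \<in> ev M22 m22_gen ` words {0, 1, 2}"
        using t by (intro image_eqI[of _ _ gt]) (simp_all only: ev_M22 eqs(1) m22_a_eq)
      show "m22_b \<in> ev M22 m22_gen ` words {0, 1, 2}"
        using b by (intro image_eqI[of _ _ ?b]) (simp_all only: ev_M22 eqs(2) m22_b_eq)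
    qed
  next
    case (inv h)
    then show ?case
    proof safe
      show "inv\<^bsub>sym_group 22\<^esub> m22_a \<in> ev M22 m22_gen ` words {0, 1, 2}"
        unfolding inv_ab using t by (intro image_eqI[of _ _ gt]) (simp_all only: ev_M22 eqs(1))
      show "inv\<^bsub>sym_group 22\<^esub> m22_b \<in> ev M22 m22_gen ` words {0, 1, 2}"
        unfolding inv_ab using b
        by (intro image_eqI[of _ _ "?b @ ?b @ ?b"]) (simp_all only: ev_M22 eqs(3), auto)
    qed
  next
    case (eng f g)
    then obtain u v where uv: "u \<in> words {0, 1, 2}" "v \<in> words {0, 1, 2}"
      "f = ev M22 m22_gen u" "g = ev M22 m22_gen v" by blast
    have "m22_gen ` {0, 1, 2} \<subseteq> carrier M22" using m22_gen_closed by blast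
    from group.ev_append[OF M22_group this uv(1,2)]
    have "f \<otimes>\<^bsub>sym_group 22\<^esub> g = ev M22 m22_gen (u @ v)" by (simp add: uv sym_group_def)
    moreover have "u @ v \<in> words {0, 1, 2}" using uv by auto
    ultimately show ?case by blast
  qed
qed

text \<open>Stated for any subset of the relators so as to serve both groups: the same three
  permutations satisfy every smaller set of relations, and surjectivity depends on the permutations
  alone.\<close>

lemma presentation_epi:
  assumes "presentation {0, 1, 2} R" "R \<subseteq> G_relators"
  shows "\<exists>h. h \<in> epi (presented_group {0, 1, 2} R) M22"
proof -
  interpret presentation "{0, 1, 2}" R by fact
  have gens: "m22_gen ` {0, 1, 2} \<subseteq> carrier M22" using m22_gen_closed by blast
  obtain h where h: "h \<in> hom PG M22" "\<And>w. w \<in> words {0, 1, 2} \<Longrightarrow> h (ev PG cls w) = ev M22 m22_gen w"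
    using universal_property[OF M22_group gens] ev_M22_relators assms(2) by blast
  have "carrier M22 \<subseteq> h ` carrier PG"
    using ev_M22_surj h(2) unfolding carrier_PG image_image by (metis (no_types, lifting) image_cong)
  then have "h \<in> epi PG M22" using h(1) by (auto simp: epi_def hom_def)
  then show ?thesis by blast
qed

theorem mainTheorem1:
  shows "G_pres \<cong> M22 \<and> (\<exists>h. h \<in> epi progenitor M22)"
proof
  obtain h where "h \<in> epi G_pres M22"
    using presentation_epi[OF GP.presentation_axioms] by (auto simp: G_pres_def)
  then have h: "h \<in> hom G_pres M22" "h ` carrier G_pres = carrier M22" by (auto simp: epi_def)
  \<comment> \<open>Both sides are squeezed to 443520: the image is all of \<open>M22\<close>, of
    order at least 443520, and \<open>G_pres\<close> has at most that order.\<close>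
  have "card (h ` carrier G_pres) = card (carrier G_pres)"
    using G_pres_bound card_M22_ge h(2) card_image_le[of "carrier G_pres" h] by simp
  then have "inj_on h (carrier G_pres)"
    using eq_card_imp_inj_on G_pres_bound by blast
  with h have "h \<in> iso G_pres M22" by (simp add: iso_def bij_betw_def)
  then show "G_pres \<cong> M22" by (auto simp: is_iso_def)
  show "\<exists>h. h \<in> epi progenitor M22"
    unfolding progenitor_def by (rule presentation_epi[OF PP.presentation_axioms]) (auto simp: G_relators_def)
qed

end
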